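(* Let $d\ge1$ and $\mu\in(-1,1)$. Let $A_0=C^*(t_i,t_i^*,\ i=1,\dots,d)$ be a unital $C^*$-algebra of Hilbert space operators generated by operators satisfying $$t_i^*t_j=\delta_{ij}\Bigl(1-\sum_{k<i}t_kt_k^*\Bigr),\ i,j=1,\dots,d,\qquad t_jt_i=0,\ j>i.$$ For $1\le j\le i\le d$ define inductively $$a_i^{(i)}=\Bigl(\sum_{n=1}^\infty\mu^{2(n-1)}t_i^nt_i^{*n}\Bigr)^{1/2}t_i,\qquad a_i^{(j)}=\sum_{n=0}^\infty\mu^nt_j^na_i^{(j+1)}t_j^{*n},\ j=1,\dots,i-1,$$ and put $\widetilde a_i:=a_i^{(1)}$, $i=1,\dots,d$. Then $$\widetilde a_i^*\widetilde a_i=1+\mu^2\widetilde a_i\widetilde a_i^*-(1-\mu^2)\sum_{k<i}\widetilde a_k\widetilde a_k^*,\quad i=1,\dots,d,$$ $$\widetilde a_i^*\widetilde a_j=\mu\widetilde a_j\widetilde a_i^*,\ i\ne j,\qquad \widetilde a_j\widetilde a_i=\mu\widetilde a_i\widetilde a_j,\ i<j,$$ and $\widehat S_i(\widetilde a_1,\dots,\widetilde a_d)=t_i$ for $i=1,\dots,d$.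
   Context: The series converge in norm, and $\mu^0=1$ also when $\mu=0$. For operators $a_1,\dots,a_d$ on a Hilbert space, the operators $\widehat S_i=\widehat S_i(a_1,\dots,a_d)$ are defined as follows. Let $a_i^*=S_i^*C_i$ be the polar decomposition, i.e. $C_i=(a_ia_i^* )^{1/2}$ and $S_i^*$ is the partial isometry with $\ker S_i^*=\ker C_i=\ker a_i^*$. Then $$\widehat S_1:=S_1,\qquad \widehat S_i:=\Bigl(1-\sum_{j<i}\widehat S_j\widehat S_j^*\Bigr)S_i,\ i=2,\dots,d.$$ *)

theory Defs
  imports "HOL-Analysis.Analysis"
begin

class scaleC = scaleR +
  fixes scaleC :: "complex \<Rightarrow> 'a \<Rightarrow> 'a" (infixr "*\<^sub>C" 75)

text \<open>The inner product is conjugate-linear in the first argument; positivity and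
  definiteness are contained in \<open>cinner_self\<close>.\<close>

class complex_hilbert_space = scaleC + banach +
  fixes cinner :: "'a \<Rightarrow> 'a \<Rightarrow> complex"
  assumes scaleC_add_right: "c *\<^sub>C (x + y) = c *\<^sub>C x + c *\<^sub>C y"
    and scaleC_add_left: "(b + c) *\<^sub>C x = b *\<^sub>C x + c *\<^sub>C x"
    and scaleC_scaleC: "b *\<^sub>C c *\<^sub>C x = (b * c) *\<^sub>C x"
    and scaleC_one: "1 *\<^sub>C x = x"
    and scaleR_scaleC: "r *\<^sub>R x = complex_of_real r *\<^sub>C x"
    and cinner_commute: "cinner x y = cnj (cinner y x)"
    and cinner_add_right: "cinner x (y + z) = cinner x y + cinner x z"
    and cinner_scaleC_right: "cinner x (c *\<^sub>C y) = c * cinner x y"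
    and cinner_self: "cinner x x = complex_of_real ((norm x)\<^sup>2)"

lemma cinner_scaleC_left:
  "cinner (c *\<^sub>C x) (y :: 'h::complex_hilbert_space) = cnj c * cinner x y"
  by (subst cinner_commute, simp add: cinner_scaleC_right, subst cinner_commute, simp)

lemma norm_scaleC: "norm (c *\<^sub>C (x :: 'h::complex_hilbert_space)) = cmod c * norm x"
proof -
  have "complex_of_real ((norm (c *\<^sub>C x))\<^sup>2) = (c * cnj c) * cinner x x"
    by (subst cinner_self[symmetric]) (simp add: cinner_scaleC_left cinner_scaleC_right mult_ac)
  also have "\<dots> = complex_of_real ((cmod c * norm x)\<^sup>2)"
    by (simp add: cinner_self complex_norm_square[symmetric] power_mult_distrib)
  finally have "(norm (c *\<^sub>C x))\<^sup>2 = (cmod c * norm x)\<^sup>2"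
    by (simp only: of_real_eq_iff)
  then show ?thesis
    by (simp add: power2_eq_iff_nonneg)
qed

lemma bounded_linear_scaleC: "bounded_linear (\<lambda>x :: 'h::complex_hilbert_space. c *\<^sub>C x)"
  by (rule bounded_linear_intro[where K = "cmod c"])
    (auto simp: scaleC_add_right scaleR_scaleC scaleC_scaleC norm_scaleC mult.commute)

typedef (overloaded) ('h::complex_hilbert_space) bop =
  "{f :: 'h \<Rightarrow>\<^sub>L 'h. \<forall>c x. blinfun_apply f (c *\<^sub>C x) = c *\<^sub>C blinfun_apply f x}"
  morphisms blinfun_of_bop Bop
  by (rule exI[of _ id_blinfun]) simp

setup_lifting type_definition_bop

lift_definition bop_apply :: "'h::complex_hilbert_space bop \<Rightarrow> 'h \<Rightarrow> 'h" is blinfun_apply .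

lemma scaleC_zero_right [simp]: "c *\<^sub>C (0 :: 'h::complex_hilbert_space) = 0"
  by (rule linear_0[OF bounded_linear.linear[OF bounded_linear_scaleC]])

lemma scaleC_minus_right: "c *\<^sub>C (- x :: 'h::complex_hilbert_space) = - (c *\<^sub>C x)"
  by (rule linear_neg[OF bounded_linear.linear[OF bounded_linear_scaleC]])

lemma scaleC_diff_right:
  "c *\<^sub>C (x - y :: 'h::complex_hilbert_space) = c *\<^sub>C x - c *\<^sub>C y"
  by (rule linear_diff[OF bounded_linear.linear[OF bounded_linear_scaleC]])

instantiation bop :: (complex_hilbert_space) real_normed_algebra
begin

lift_definition zero_bop :: "'a bop" is 0 by simp
lift_definition plus_bop :: "'a bop \<Rightarrow> 'a bop \<Rightarrow> 'a bop" is "(+)"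
  by (simp add: blinfun.add_left scaleC_add_right)
lift_definition minus_bop :: "'a bop \<Rightarrow> 'a bop \<Rightarrow> 'a bop" is "(-)"
  by (simp add: blinfun.diff_left scaleC_diff_right)
lift_definition uminus_bop :: "'a bop \<Rightarrow> 'a bop" is uminus
  by (simp add: blinfun.minus_left scaleC_minus_right)
lift_definition times_bop :: "'a bop \<Rightarrow> 'a bop \<Rightarrow> 'a bop" is "(o\<^sub>L)"
  by simp
lift_definition scaleR_bop :: "real \<Rightarrow> 'a bop \<Rightarrow> 'a bop" is scaleR
  by (simp add: blinfun.scaleR_left scaleR_scaleC scaleC_scaleC mult.commute)
lift_definition norm_bop :: "'a bop \<Rightarrow> real" is norm .

definition sgn_bop :: "'a bop \<Rightarrow> 'a bop" where
  "sgn_bop A = inverse (norm A) *\<^sub>R A"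
definition dist_bop :: "'a bop \<Rightarrow> 'a bop \<Rightarrow> real" where
  "dist_bop A B = norm (A - B)"
definition uniformity_bop :: "('a bop \<times> 'a bop) filter" where
  "uniformity_bop = (INF e\<in>{0<..}. principal {(A, B). dist A B < e})"
definition open_bop :: "'a bop set \<Rightarrow> bool" where
  "open_bop U = (\<forall>A\<in>U. eventually (\<lambda>(A', B). A' = A \<longrightarrow> B \<in> U) uniformity)"

instance
proof
  fix A B :: "'a bop"
  show "norm (A * B) \<le> norm A * norm B"
    by transfer (rule norm_blinfun_compose)
qed (simp_all add: sgn_bop_def dist_bop_def uniformity_bop_def open_bop_def,
     (transfer; auto simp: algebra_simps blinfun_eqI blinfun.bilinear_simps norm_triangle_ineq)+)

end

instantiation bop :: (complex_hilbert_space) monoid_mult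
begin
lift_definition one_bop :: "'a bop" is id_blinfun by simp
instance by standard (transfer; auto intro!: blinfun_eqI)+
end

instance bop :: (complex_hilbert_space) banach
proof
  fix X :: "nat \<Rightarrow> 'a bop"
  assume "Cauchy X"
  have dist: "dist (blinfun_of_bop A) (blinfun_of_bop B) = dist A B" for A B :: "'a bop"
    unfolding dist_norm by transfer simp
  have "Cauchy (\<lambda>n. blinfun_of_bop (X n))"
    using \<open>Cauchy X\<close> by (simp add: Cauchy_def dist)
  then obtain L where L: "(\<lambda>n. blinfun_of_bop (X n)) \<longlonglongrightarrow> L"
    using Cauchy_convergent convergent_def by blast
  have lim: "(\<lambda>n. blinfun_apply (blinfun_of_bop (X n)) x) \<longlonglongrightarrow> blinfun_apply L x" for x
    by (intro tendsto_intros L)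
  have "blinfun_apply L (c *\<^sub>C x) = c *\<^sub>C blinfun_apply L x" for c x
  proof (rule LIMSEQ_unique[OF lim])
    have "blinfun_apply (blinfun_of_bop A) (c *\<^sub>C x) = c *\<^sub>C blinfun_apply (blinfun_of_bop A) x" for A
      using blinfun_of_bop[of A] by simp
    then show "(\<lambda>n. blinfun_apply (blinfun_of_bop (X n)) (c *\<^sub>C x)) \<longlonglongrightarrow> c *\<^sub>C blinfun_apply L x"
      by (simp add: bounded_linear.tendsto[OF bounded_linear_scaleC lim])
  qed
  then have "blinfun_of_bop (Bop L) = L"
    by (simp add: Bop_inverse)
  with L have "X \<longlonglongrightarrow> Bop L"
    by (simp add: lim_sequentially dist[symmetric])
  then show "convergent X"
    by (auto simp: convergent_def)
qed

instantiation bop :: (complex_hilbert_space) scaleC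
begin
lift_definition scaleC_bop :: "complex \<Rightarrow> 'a bop \<Rightarrow> 'a bop" is
  "\<lambda>c A. Blinfun (\<lambda>x. c *\<^sub>C blinfun_apply A x)"
  by (simp add: bounded_linear_Blinfun_apply bounded_linear_compose[OF bounded_linear_scaleC]
      blinfun.bounded_linear_right scaleC_scaleC mult.commute)
instance ..
end

lemma bop_apply_simps:
  "bop_apply 0 x = 0" "bop_apply 1 x = x"
  "bop_apply (A + B) x = bop_apply A x + bop_apply B x"
  "bop_apply (A - B) x = bop_apply A x - bop_apply B x"
  "bop_apply (- A) x = - bop_apply A x"
  "bop_apply (A * B) x = bop_apply A (bop_apply B x)"
  "bop_apply (r *\<^sub>R A) x = r *\<^sub>R bop_apply A x"
  "bop_apply (c *\<^sub>C A) x = c *\<^sub>C bop_apply A x"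
  by (transfer; simp add: blinfun.bilinear_simps bounded_linear_Blinfun_apply
      bounded_linear_compose[OF bounded_linear_scaleC] blinfun.bounded_linear_right)+

definition adj :: "'h::complex_hilbert_space bop \<Rightarrow> 'h bop" where
  "adj A = (THE B. \<forall>x y. cinner (bop_apply A x) y = cinner x (bop_apply B y))"

definition op_ker :: "'h::complex_hilbert_space bop \<Rightarrow> 'h set" where
  "op_ker A = {x. bop_apply A x = 0}"

definition positive_op :: "'h::complex_hilbert_space bop \<Rightarrow> bool" where
  "positive_op A \<longleftrightarrow> (\<forall>x. cinner x (bop_apply A x) \<in> \<real>\<^sub>\<ge>\<^sub>0)"

definition op_sqrt :: "'h::complex_hilbert_space bop \<Rightarrow> 'h bop" where
  "op_sqrt A = (THE B. positive_op B \<and> B * B = A)"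

definition partial_isometry :: "'h::complex_hilbert_space bop \<Rightarrow> bool" where
  "partial_isometry V \<longleftrightarrow>
    (\<forall>x. (\<forall>y\<in>op_ker V. cinner y x = 0) \<longrightarrow> norm (bop_apply V x) = norm x)"

definition unital_cstar_subalgebra :: "'h::complex_hilbert_space bop set \<Rightarrow> bool" where
  "unital_cstar_subalgebra M \<longleftrightarrow> closed M \<and> 1 \<in> M \<and>
    (\<forall>A\<in>M. \<forall>B\<in>M. A + B \<in> M \<and> A * B \<in> M) \<and>
    (\<forall>A\<in>M. adj A \<in> M \<and> (\<forall>c. c *\<^sub>C A \<in> M))"

text \<open>\<open>polar_S a\<close> is the operator \<open>S\<close> whose adjoint is the partial isometry in the polar
  decomposition \<open>a\<^sup>* = S\<^sup>* C\<close>, with \<open>C = (a a\<^sup>*)\<^sup>1\<^sup>/\<^sup>2\<close>.\<close>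

definition polar_S :: "'h::complex_hilbert_space bop \<Rightarrow> 'h bop" where
  "polar_S a = (let C = op_sqrt (a * adj a) in
     adj (THE V. partial_isometry V \<and> adj a = V * C \<and> op_ker V = op_ker C))"

text \<open>Families of operators are indexed from 1.\<close>

fun hat_S :: "(nat \<Rightarrow> 'h::complex_hilbert_space bop) \<Rightarrow> nat \<Rightarrow> 'h bop" where
  "hat_S a i = (1 - (\<Sum>j\<in>{1..<i}. hat_S a j * adj (hat_S a j))) * polar_S (a i)"

declare hat_S.simps [simp del]

text \<open>The summation index of the \<open>diag_term\<close> series is shifted to start at 0.\<close>

definition diag_term :: "real \<Rightarrow> (nat \<Rightarrow> 'h::complex_hilbert_space bop) \<Rightarrow> nat \<Rightarrow> nat \<Rightarrow> 'h bop" where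
  "diag_term \<mu> t i n = \<mu> ^ (2 * n) *\<^sub>R (t i ^ Suc n * adj (t i) ^ Suc n)"

text \<open>\<open>a_stage \<mu> t i j\<close> is \<open>a\<^sub>i\<^sup>(\<^sup>j\<^sup>)\<close> for \<open>1 \<le> j \<le> i\<close>; for \<open>j > i\<close> it has no meaning.\<close>

function a_stage :: "real \<Rightarrow> (nat \<Rightarrow> 'h::complex_hilbert_space bop) \<Rightarrow> nat \<Rightarrow> nat \<Rightarrow> 'h bop" where
  "a_stage \<mu> t i j =
    (if j < i then \<Sum>n. \<mu> ^ n *\<^sub>R (t j ^ n * a_stage \<mu> t i (Suc j) * adj (t j) ^ n)
     else op_sqrt (\<Sum>n. diag_term \<mu> t i n) * t i)"
  by pat_completeness auto
termination
  by (relation "Wellfounded.measure (\<lambda>(\<mu>, t, i, j). i - j)") auto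

declare a_stage.simps [simp del]

definition a_tilde :: "real \<Rightarrow> (nat \<Rightarrow> 'h::complex_hilbert_space bop) \<Rightarrow> nat \<Rightarrow> 'h bop" where
  "a_tilde \<mu> t i = a_stage \<mu> t i 1"

end

theory Submission
  imports Defs
begin

text \<open>For a contraction \<open>t\<close> and \<open>\<bar>\<nu>\<bar> < 1\<close>, the sum \<open>\<Sum>n. \<nu>\<^sup>n t\<^sup>n X t\<^sup>*\<^sup>n\<close> is the unique solution \<open>Z\<close> of
  \<open>Z = X + \<nu> t Z t\<^sup>*\<close>. Comparing fixed-point equations shows that it behaves multiplicatively in
  the pair \<open>(\<nu>, X)\<close> on operators annihilated by \<open>t\<^sup>*\<close> from the left and by \<open>t\<close> from the right,
  so every relation between the operators \<open>a\<^sub>i\<close> can be checked in the corner cut out by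
  \<open>Q\<^sub>i = 1 - \<Sum>k<i. t\<^sub>k t\<^sub>k\<^sup>*\<close>, on which \<open>t\<^sub>i\<close> is an isometry. There the square root in
  \<open>a\<^sub>i\<^sup>(\<^sup>i\<^sup>)\<close> is an explicit weighted sum of the projections \<open>t\<^sub>i\<^sup>n t\<^sub>i\<^sup>*\<^sup>n\<close>. The same construction with
  \<open>\<bar>\<mu>\<bar>\<close> in place of \<open>\<mu>\<close> gives the modulus of \<open>a\<^sub>i\<^sup>*\<close>, and the polar decomposition is then
  identified on the corner.\<close>

section \<open>Complex Hilbert spaces and adjoints\<close>

lemma cinner_add_left: "cinner (x + y) (z :: 'h::complex_hilbert_space) = cinner x z + cinner y z"
  by (metis cinner_add_right cinner_commute complex_cnj_add)

lemma cinner_scaleR_right: "cinner (x :: 'h::complex_hilbert_space) (r *\<^sub>R y) = r *\<^sub>R cinner x y"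
  by (simp add: scaleR_scaleC cinner_scaleC_right scaleR_conv_of_real)

lemma cinner_scaleR_left: "cinner (r *\<^sub>R x :: 'h::complex_hilbert_space) y = r *\<^sub>R cinner x y"
  by (simp add: scaleR_scaleC cinner_scaleC_left scaleR_conv_of_real)

lemma cinner_zero_right [simp]: "cinner (x :: 'h::complex_hilbert_space) 0 = 0"
  using cinner_scaleR_right[of x 0 0] by simp

lemma cinner_zero_left [simp]: "cinner 0 (x :: 'h::complex_hilbert_space) = 0"
  using cinner_scaleR_left[of 0 0 x] by simp

lemma cinner_diff_right: "cinner (x :: 'h::complex_hilbert_space) (y - z) = cinner x y - cinner x z"
  using cinner_add_right[of x "y - z" z] by simp

lemma cinner_diff_left: "cinner (x - y :: 'h::complex_hilbert_space) z = cinner x z - cinner y z"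
  using cinner_add_left[of "x - y" y z] by simp

lemma cinner_eq_0_commute: "cinner x y = 0 \<longleftrightarrow> cinner y (x :: 'h::complex_hilbert_space) = 0"
  by (metis cinner_commute complex_cnj_zero_iff)

lemma cinner_self_eq_0 [simp]: "cinner x x = 0 \<longleftrightarrow> (x :: 'h::complex_hilbert_space) = 0"
  by (simp add: cinner_self)

lemma Re_cinner_commute: "Re (cinner x y) = Re (cinner y (x :: 'h::complex_hilbert_space))"
  by (subst cinner_commute) simp

lemma norm_squared_cinner: "(norm (x :: 'h::complex_hilbert_space))\<^sup>2 = Re (cinner x x)"
  by (simp add: cinner_self)

lemma norm_diff_squared:
  "(norm (x - y :: 'h::complex_hilbert_space))\<^sup>2 = (norm x)\<^sup>2 - 2 * Re (cinner x y) + (norm y)\<^sup>2"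
  using Re_cinner_commute[of x y]
  by (simp add: norm_squared_cinner cinner_diff_left cinner_diff_right)

lemma norm_add_squared:
  "(norm (x + y :: 'h::complex_hilbert_space))\<^sup>2 = (norm x)\<^sup>2 + 2 * Re (cinner x y) + (norm y)\<^sup>2"
  using Re_cinner_commute[of x y]
  by (simp add: norm_squared_cinner cinner_add_left cinner_add_right)

text \<open>Removing the component of \<open>x\<close> along \<open>y\<close> serves twice:
  nonnegativity of the result is Cauchy-Schwarz, and the fact that it cannot fall below a minimal
  distance gives orthogonality in the projection theorem.\<close>

lemma norm_diff_component_squared:
  fixes x y :: "'h::complex_hilbert_space"
  assumes "y \<noteq> 0"
  shows "(norm (x - (cinner y x / complex_of_real ((norm y)\<^sup>2)) *\<^sub>C y))\<^sup>2 =
    (norm x)\<^sup>2 - (cmod (cinner y x))\<^sup>2 / (norm y)\<^sup>2"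
proof -
  let ?c = "cinner y x / complex_of_real ((norm y)\<^sup>2)"
  have "cinner x (?c *\<^sub>C y) = ?c * cnj (cinner y x)"
    by (metis cinner_commute cinner_scaleC_right)
  also have "\<dots> = complex_of_real ((cmod (cinner y x))\<^sup>2 / (norm y)\<^sup>2)"
    by (simp add: complex_norm_square[symmetric])
  finally have 1: "Re (cinner x (?c *\<^sub>C y)) = (cmod (cinner y x))\<^sup>2 / (norm y)\<^sup>2"
    by simp
  have "norm (?c *\<^sub>C y) = cmod (cinner y x) / norm y"
    using assms by (simp add: norm_scaleC norm_divide norm_power) (simp add: power2_eq_square)
  then show ?thesis
    unfolding norm_diff_squared 1 by (simp add: power_divide)
qed

lemma cinner_Cauchy_Schwarz: "cmod (cinner x y) \<le> norm x * norm (y :: 'h::complex_hilbert_space)"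
proof (cases "x = 0")
  case False
  have "(cmod (cinner x y))\<^sup>2 / (norm x)\<^sup>2 \<le> (norm y)\<^sup>2"
    using norm_diff_component_squared[OF False, of y] zero_le_power2 by (metis diff_ge_0_iff_ge)
  then have "(cmod (cinner x y))\<^sup>2 \<le> (norm x * norm y)\<^sup>2"
    using False by (simp add: divide_le_eq power_mult_distrib mult.commute)
  then show ?thesis
    by (rule power2_le_imp_le) simp
qed simp

lemma bounded_bilinear_cinner:
  "bounded_bilinear (cinner :: 'h::complex_hilbert_space \<Rightarrow> 'h \<Rightarrow> complex)"
  by standard
    (auto simp: cinner_add_left cinner_add_right cinner_scaleR_left cinner_scaleR_right
      intro!: exI[of _ 1] cinner_Cauchy_Schwarz)

lemmas tendsto_cinner [tendsto_intros] = bounded_bilinear.tendsto[OF bounded_bilinear_cinner]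

lemma tendsto_scaleC [tendsto_intros]:
  "(f \<longlongrightarrow> (l :: 'h::complex_hilbert_space)) F \<Longrightarrow> ((\<lambda>x. c *\<^sub>C f x) \<longlongrightarrow> c *\<^sub>C l) F"
  by (rule bounded_linear.tendsto[OF bounded_linear_scaleC])

section \<open>Closed subspaces and orthogonal projection\<close>

definition csubspace :: "'h::complex_hilbert_space set \<Rightarrow> bool" where
  "csubspace M \<longleftrightarrow> 0 \<in> M \<and> (\<forall>x\<in>M. \<forall>y\<in>M. x + y \<in> M) \<and> (\<forall>x\<in>M. \<forall>c. c *\<^sub>C x \<in> M)"

lemma csubspace_closure:
  assumes "csubspace (M :: 'h::complex_hilbert_space set)"
  shows "csubspace (closure M)"
  unfolding csubspace_def
proof (intro conjI ballI allI)
  show "0 \<in> closure M"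
    using assms closure_subset unfolding csubspace_def by blast
next
  fix x y assume "x \<in> closure M" "y \<in> closure M"
  then obtain f g where "\<And>n. f n \<in> M" "f \<longlonglongrightarrow> x" "\<And>n. g n \<in> M" "g \<longlonglongrightarrow> y"
    by (auto simp: closure_sequential)
  then have "\<forall>n. f n + g n \<in> M" "(\<lambda>n. f n + g n) \<longlonglongrightarrow> x + y"
    using assms by (simp_all add: csubspace_def tendsto_add)
  then show "x + y \<in> closure M"
    by (metis closure_sequential)
next
  fix x c assume "x \<in> closure M"
  then obtain f where "\<And>n. f n \<in> M" "f \<longlonglongrightarrow> x"
    by (auto simp: closure_sequential)
  then have "\<forall>n. c *\<^sub>C f n \<in> M" "(\<lambda>n. c *\<^sub>C f n) \<longlonglongrightarrow> c *\<^sub>C x"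
    using assms by (simp_all add: csubspace_def tendsto_scaleC)
  then show "c *\<^sub>C x \<in> closure M"
    by (metis closure_sequential)
qed

text \<open>The parallelogram law makes a distance-minimising sequence in \<open>M\<close> Cauchy;
  its limit is the foot of the perpendicular.\<close>

theorem orthogonal_projection_exists:
  fixes M :: "'h::complex_hilbert_space set"
  assumes M: "csubspace M" and "closed M"
  shows "\<exists>m\<in>M. \<forall>y\<in>M. cinner y (x - m) = 0"
proof -
  define \<delta> where "\<delta> = infdist x M"
  have ne: "M \<noteq> {}" using M unfolding csubspace_def by blast
  have \<delta>_le: "\<delta> \<le> norm (x - m)" if "m \<in> M" for m
    using infdist_le[OF that, of x] by (simp add: \<delta>_def dist_norm)
  have \<delta>0: "\<delta> \<ge> 0" by (simp add: \<delta>_def infdist_nonneg)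
  have "\<exists>m\<in>M. norm (x - m) < \<delta> + inverse (Suc k)" for k
  proof (rule ccontr)
    assume "\<not> ?thesis"
    then have "\<delta> + inverse (Suc k) \<le> dist x m" if "m \<in> M" for m
      using that by (auto simp: dist_norm not_less)
    then have "\<delta> + inverse (Suc k) \<le> infdist x M"
      using ne cINF_greatest[OF ne] by (auto simp: infdist_def)
    then have "\<delta> + inverse (Suc k) \<le> \<delta>"
      by (simp only: \<delta>_def)
    then show False by (simp add: field_simps)
  qed
  then obtain m where mM: "\<And>k. m k \<in> M" and m: "\<And>k. norm (x - m k) < \<delta> + inverse (Suc k)"
    by metis
  have conv: "(\<lambda>k. \<delta> + inverse (real (Suc k))) \<longlonglongrightarrow> \<delta> + 0"
    by (intro tendsto_intros LIMSEQ_inverse_real_of_nat)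
  have par: "(norm (m k - m l))\<^sup>2 \<le> 2 * (norm (x - m k))\<^sup>2 + 2 * (norm (x - m l))\<^sup>2 - 4 * \<delta>\<^sup>2" for k l
  proof -
    \<comment> \<open>The midpoint of two members of \<open>M\<close> lies in \<open>M\<close>, so
      its distance from \<open>x\<close> is at least \<delta>.\<close>
    let ?h = "(1/2 :: complex) *\<^sub>C (m k + m l)"
    have half: "?h + ?h = m k + m l"
      by (simp add: scaleC_add_left[symmetric] scaleC_one)
    have "?h \<in> M" using M mM unfolding csubspace_def by blast
    then have "4 * \<delta>\<^sup>2 \<le> (2 * norm (x - ?h))\<^sup>2"
      using \<delta>_le[of ?h] \<delta>0 by (simp add: power_mono power_mult_distrib)
    also have "2 * norm (x - ?h) = norm ((x - ?h) + (x - ?h))"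
      by (simp add: scaleR_2[symmetric])
    also have "(x - ?h) + (x - ?h) = (x - m k) + (x - m l)"
      using half by (simp add: algebra_simps)
    finally have "4 * \<delta>\<^sup>2 \<le> (norm ((x - m k) + (x - m l)))\<^sup>2" .
    moreover have "(norm (m k - m l))\<^sup>2 = (norm ((x - m k) - (x - m l)))\<^sup>2"
      by (simp add: norm_minus_commute)
    ultimately show ?thesis
      unfolding norm_add_squared norm_diff_squared[of "x - m k" "x - m l"] by simp
  qed
  have "Cauchy m"
  proof (rule metric_CauchyI)
    fix e :: real assume e: "e > 0"
    have "(\<lambda>k. 4 * (\<delta> + inverse (real (Suc k)))\<^sup>2 - 4 * \<delta>\<^sup>2) \<longlonglongrightarrow> 4 * (\<delta> + 0)\<^sup>2 - 4 * \<delta>\<^sup>2"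
      by (intro tendsto_intros conv)
    then have "eventually (\<lambda>k. 4 * (\<delta> + inverse (real (Suc k)))\<^sup>2 - 4 * \<delta>\<^sup>2 < e\<^sup>2) sequentially"
      using e by (intro order_tendstoD) auto
    then obtain N where N: "4 * (\<delta> + inverse (real (Suc N)))\<^sup>2 - 4 * \<delta>\<^sup>2 < e\<^sup>2"
      by (auto simp: eventually_sequentially)
    have bd: "(norm (x - m k))\<^sup>2 \<le> (\<delta> + inverse (real (Suc N)))\<^sup>2" if "k \<ge> N" for k
    proof (rule power_mono)
      have "inverse (real (Suc k)) \<le> inverse (real (Suc N))"
        using that by (intro le_imp_inverse_le) auto
      then show "norm (x - m k) \<le> \<delta> + inverse (real (Suc N))"
        using m[of k] by linarith
    qed simp
    show "\<exists>M. \<forall>k\<ge>M. \<forall>l\<ge>M. dist (m k) (m l) < e"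
    proof (intro exI allI impI)
      fix k l assume "N \<le> k" "N \<le> l"
      then have "(norm (m k - m l))\<^sup>2 < e\<^sup>2"
        using par[of k l] bd[of k] bd[of l] N by linarith
      then show "dist (m k) (m l) < e"
        using e by (simp add: dist_norm power_less_imp_less_base)
    qed
  qed
  then obtain p where p: "m \<longlonglongrightarrow> p"
    using Cauchy_convergent convergent_def by blast
  have pM: "p \<in> M"
    using \<open>closed M\<close> mM p closed_sequentially by blast
  have le: "norm (x - p) \<le> \<delta>"
  proof (rule LIMSEQ_le)
    show "(\<lambda>k. norm (x - m k)) \<longlonglongrightarrow> norm (x - p)"
      by (intro tendsto_intros p)
    show "(\<lambda>k. \<delta> + inverse (real (Suc k))) \<longlonglongrightarrow> \<delta>" using conv by simp
    show "\<exists>N. \<forall>n\<ge>N. norm (x - m n) \<le> \<delta> + inverse (real (Suc n))"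
      using m less_imp_le by blast
  qed
  have "cinner y (x - p) = 0" if "y \<in> M" for y
  proof (cases "y = 0")
    case False
    \<comment> \<open>Moving \<open>p\<close> by the component of \<open>x - p\<close> along
      \<open>y\<close> would shorten the distance unless the inner product vanishes.\<close>
    let ?c = "cinner y (x - p) / complex_of_real ((norm y)\<^sup>2)"
    have "p + ?c *\<^sub>C y \<in> M" using M pM that unfolding csubspace_def by blast
    then have "norm (x - p) \<le> norm (x - p - ?c *\<^sub>C y)"
      using \<delta>_le le by (metis diff_diff_eq order_trans)
    then have "(norm (x - p))\<^sup>2 \<le> (norm (x - p - ?c *\<^sub>C y))\<^sup>2"
      by (simp add: power_mono)
    then have "(cmod (cinner y (x - p)))\<^sup>2 / (norm y)\<^sup>2 \<le> 0"
      unfolding norm_diff_component_squared[OF False] by simp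
    then show ?thesis using False by (simp add: divide_le_0_iff)
  qed simp
  then show ?thesis using pM by blast
qed

section \<open>Bounded operators, Riesz representation and adjoints\<close>

lemma bop_exists:
  fixes f :: "'h::complex_hilbert_space \<Rightarrow> 'h"
  assumes "\<And>x y. f (x + y) = f x + f y" "\<And>c x. f (c *\<^sub>C x) = c *\<^sub>C f x"
    and "\<And>x. norm (f x) \<le> norm x * K"
  shows "\<exists>A. bop_apply A = f"
proof -
  have bl: "bounded_linear f"
    by (rule bounded_linear_intro[where K = K]) (simp_all add: assms scaleR_scaleC)
  have "bop_apply (Bop (Blinfun f)) = f"
    using bl by (simp add: bop_apply.rep_eq Bop_inverse bounded_linear_Blinfun_apply assms(2))
  then show ?thesis ..
qed

lemma bop_eqI: "(\<And>x. bop_apply A x = bop_apply B x) \<Longrightarrow> A = B"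
  by transfer (auto intro: blinfun_eqI)

lemma norm_bop_apply: "norm (bop_apply A x) \<le> norm A * norm x"
  by transfer (rule norm_blinfun)

lemma norm_bop_bound: "0 \<le> K \<Longrightarrow> (\<And>x. norm (bop_apply A x) \<le> K * norm x) \<Longrightarrow> norm A \<le> K"
  by transfer (rule norm_blinfun_bound)

lemma bounded_bilinear_bop_apply:
  "bounded_bilinear (bop_apply :: 'h::complex_hilbert_space bop \<Rightarrow> 'h \<Rightarrow> 'h)"
proof
  fix A B :: "'h bop" and x y :: 'h and r :: real
  show "bop_apply A (x + y) = bop_apply A x + bop_apply A y"
    by transfer (simp add: blinfun.add_right)
  show "bop_apply A (r *\<^sub>R x) = r *\<^sub>R bop_apply A x"
    by transfer (simp add: blinfun.scaleR_right)
  show "\<exists>K. \<forall>(A :: 'h bop) x. norm (bop_apply A x) \<le> norm A * norm x * K"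
    using norm_bop_apply by (intro exI[of _ 1]) auto
qed (simp_all add: bop_apply_simps)

interpretation bop: bounded_bilinear "bop_apply :: 'h::complex_hilbert_space bop \<Rightarrow> 'h \<Rightarrow> 'h"
  by (rule bounded_bilinear_bop_apply)

lemma bop_apply_scaleC: "bop_apply A (c *\<^sub>C x) = c *\<^sub>C bop_apply A x"
  by transfer simp

text \<open>The kernel of \<open>f\<close> is closed, and a vector off it has a nonzero component
  \<open>w\<close> orthogonal to it. Every \<open>x\<close> is a multiple of \<open>w\<close> plus a
  kernel element, so a multiple of \<open>w\<close> represents \<open>f\<close>.\<close>

theorem Riesz_representation:
  fixes f :: "'h::complex_hilbert_space \<Rightarrow> complex"
  assumes add: "\<And>x y. f (x + y) = f x + f y" and scale: "\<And>c x. f (c *\<^sub>C x) = c * f x"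
    and bound: "\<And>x. cmod (f x) \<le> norm x * K"
  shows "\<exists>z. \<forall>x. f x = cinner z x"
proof (cases "\<forall>x. f x = 0")
  case True
  then show ?thesis by (intro exI[of _ 0]) simp
next
  case False
  then obtain u where u: "f u \<noteq> 0" by blast
  have bl: "bounded_linear f"
    by (rule bounded_linear_intro[where K = K])
      (simp_all add: add scale bound scaleR_scaleC scaleR_conv_of_real)
  have f0: "f 0 = 0" using scale[of 0 0] by simp
  let ?M = "{x. f x = 0}"
  have "closed ?M"
    using bounded_linear.continuous_on[OF bl continuous_on_id]
    by (intro closed_Collect_eq) (auto intro: continuous_on_const)
  moreover have "csubspace ?M"
    by (auto simp: csubspace_def add scale f0)
  ultimately obtain p where p: "f p = 0" "\<And>y. f y = 0 \<Longrightarrow> cinner y (u - p) = 0"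
    using orthogonal_projection_exists[of ?M u] by auto
  define w where "w = u - p"
  have fw: "f w = f u"
    using add[of w p] p(1) by (simp add: w_def)
  have w0: "w \<noteq> 0" using fw u f0 by auto
  \<comment> \<open>The conjugate compensates for the conjugate-linear first argument of
    \<open>cinner\<close>.\<close>
  have "f x = cinner (cnj (f w / cinner w w) *\<^sub>C w) x" for x
  proof -
    have "f (x + (- (f x / f w)) *\<^sub>C w) = 0"
      unfolding add scale using fw u by simp
    then have "cinner (x + (- (f x / f w)) *\<^sub>C w) w = 0"
      using p(2) by (simp add: w_def)
    then have "cinner w (x + (- (f x / f w)) *\<^sub>C w) = 0"
      by (simp add: cinner_eq_0_commute)
    then have "cinner w x = f x / f w * cinner w w"
      by (simp add: cinner_add_right cinner_scaleC_right)
    then show ?thesis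
      using w0 fw u by (simp add: cinner_scaleC_left)
  qed
  then show ?thesis by blast
qed

lemma cinner_ext: "(\<And>x. cinner x y = cinner x z) \<Longrightarrow> y = (z :: 'h::complex_hilbert_space)"
  by (metis cinner_diff_right cinner_self_eq_0 right_minus_eq)

text \<open>For each \<open>y\<close>, Riesz applied to the functional sending \<open>x\<close> to
  \<open>cinner y (bop_apply A x)\<close> yields the value of the adjoint at \<open>y\<close>.
  Testing that value against itself bounds the resulting map.\<close>

lemma adj_exists: "\<exists>B. \<forall>x y. cinner (bop_apply A x) y = cinner x (bop_apply B y)"
proof -
  have "\<exists>z. \<forall>x. cinner y (bop_apply A x) = cinner z x" for y
  proof (rule Riesz_representation)
    show "cmod (cinner y (bop_apply A x)) \<le> norm x * (norm y * norm A)" for x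
    proof -
      have "cmod (cinner y (bop_apply A x)) \<le> norm y * norm (bop_apply A x)"
        by (rule cinner_Cauchy_Schwarz)
      also have "\<dots> \<le> norm y * (norm A * norm x)"
        by (intro mult_left_mono norm_bop_apply) simp
      finally show ?thesis by (simp add: mult_ac)
    qed
  qed (simp_all add: bop.add_right bop_apply_scaleC cinner_add_right cinner_scaleC_right)
  then obtain g where g: "\<And>y x. cinner y (bop_apply A x) = cinner (g y) x" by metis
  then have g': "cinner (bop_apply A x) y = cinner x (g y)" for x y
    by (metis cinner_commute)
  have "norm (g y) \<le> norm y * norm A" for y
  proof (cases "g y = 0")
    case False
    have "(norm (g y))\<^sup>2 = cmod (cinner (bop_apply A (g y)) y)"
      by (simp add: g' cinner_self norm_power)
    also have "\<dots> \<le> norm (bop_apply A (g y)) * norm y"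
      by (rule cinner_Cauchy_Schwarz)
    also have "\<dots> \<le> norm A * norm (g y) * norm y"
      by (intro mult_right_mono norm_bop_apply) simp
    finally show ?thesis using False by (simp add: power2_eq_square mult_ac)
  qed simp
  moreover have "g (x + y) = g x + g y" "g (c *\<^sub>C x) = c *\<^sub>C g x" for x y c
    by (rule cinner_ext; simp add: g'[symmetric] cinner_add_right cinner_scaleC_right)+
  ultimately obtain B where "bop_apply B = g" using bop_exists[of g] by blast
  then show ?thesis using g' by auto
qed

lemma cinner_adj_right: "cinner x (bop_apply (adj A) y) = cinner (bop_apply A x) y"
proof -
  have "\<exists>!B. \<forall>x y. cinner (bop_apply A x) y = cinner x (bop_apply B y)"
  proof (rule ex_ex1I[OF adj_exists])
    fix B D
    assume "\<forall>x y. cinner (bop_apply A x) y = cinner x (bop_apply B y)"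
      and "\<forall>x y. cinner (bop_apply A x) y = cinner x (bop_apply D y)"
    then have "cinner x (bop_apply B y) = cinner x (bop_apply D y)" for x y
      by metis
    then show "B = D"
      by (rule bop_eqI[OF cinner_ext])
  qed
  from theI'[OF this] show ?thesis
    unfolding adj_def by metis
qed

lemma cinner_adj_left: "cinner (bop_apply (adj A) x) y = cinner x (bop_apply A y)"
  by (metis cinner_adj_right cinner_commute)

lemma adj_eqI:
  "(\<And>x y. cinner (bop_apply A x) y = cinner x (bop_apply B y)) \<Longrightarrow> adj A = B"
  by (rule bop_eqI[OF cinner_ext]) (simp add: cinner_adj_right)

lemma adj_simps [simp]:
  "adj (adj A) = A" "adj 0 = 0" "adj 1 = 1"
  "adj (A + B) = adj A + adj B" "adj (A - B) = adj A - adj B"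
  "adj (r *\<^sub>R A) = r *\<^sub>R adj A" "adj (A * B) = adj B * adj A"
  by (rule adj_eqI; simp add: bop_apply_simps cinner_adj_left cinner_adj_right cinner_add_left
      cinner_add_right cinner_diff_left cinner_diff_right cinner_scaleR_left cinner_scaleR_right)+

lemma adj_sum: "adj (\<Sum>i\<in>I. f i) = (\<Sum>i\<in>I. adj (f i))"
  by (induction I rule: infinite_finite_induct) simp_all

lemma adj_power: "adj (A ^ n) = adj A ^ n"
  by (induction n) (simp_all add: power_commutes)

lemma norm_bop_apply_squared: "(norm (bop_apply A x))\<^sup>2 = Re (cinner x (bop_apply (adj A * A) x))"
  by (simp add: bop_apply_simps cinner_adj_right norm_squared_cinner)

lemma norm_adj_le: "norm (adj A) \<le> norm A"
proof (rule norm_bop_bound)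
  fix x
  show "norm (bop_apply (adj A) x) \<le> norm A * norm x"
  proof (cases "bop_apply (adj A) x = 0")
    case False
    have "(norm (bop_apply (adj A) x))\<^sup>2 = cmod (cinner (bop_apply A (bop_apply (adj A) x)) x)"
      by (simp add: cinner_adj_right[symmetric] cinner_self norm_power)
    also have "\<dots> \<le> norm (bop_apply A (bop_apply (adj A) x)) * norm x"
      by (rule cinner_Cauchy_Schwarz)
    also have "\<dots> \<le> norm A * norm (bop_apply (adj A) x) * norm x"
      by (intro mult_right_mono norm_bop_apply) simp
    finally show ?thesis using False by (simp add: power2_eq_square mult_ac)
  qed simp
qed simp

section \<open>Positive square roots and polar decomposition\<close>

lemma positive_opD: "positive_op A \<Longrightarrow> 0 \<le> Re (cinner x (bop_apply A x))"
  by (simp add: positive_op_def complex_nonneg_Reals_iff)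

text \<open>Positivity constrains only the quadratic form. Polarisation at \<open>x + y\<close> and
  at \<open>x + \<i> *\<^sub>C y\<close> recovers symmetry from the form being real.\<close>

lemma positive_op_selfadjoint:
  assumes "positive_op A"
  shows "adj A = A"
proof (rule adj_eqI)
  fix x y
  have im: "Im (cinner z (bop_apply A z)) = 0" for z
    using assms by (simp add: positive_op_def complex_nonneg_Reals_iff)
  have "Im (cinner x (bop_apply A y)) + Im (cinner y (bop_apply A x)) = 0"
    using im[of "x + y"] im[of x] im[of y]
    by (simp add: bop.add_right cinner_add_left cinner_add_right)
  moreover have "Re (cinner x (bop_apply A y)) - Re (cinner y (bop_apply A x)) = 0"
    using im[of "x + \<i> *\<^sub>C y"] im[of x] im[of y]
    by (simp add: bop.add_right bop_apply_scaleC cinner_add_left cinner_add_right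
        cinner_scaleC_left cinner_scaleC_right)
  ultimately have "cinner x (bop_apply A y) = cnj (cinner y (bop_apply A x))"
    by (simp add: complex_eq_iff)
  then show "cinner (bop_apply A x) y = cinner x (bop_apply A y)"
    by (metis cinner_commute)
qed

lemma positive_op_add: "positive_op A \<Longrightarrow> positive_op B \<Longrightarrow> positive_op (A + B)"
  by (simp add: positive_op_def complex_nonneg_Reals_iff bop_apply_simps cinner_add_right)

lemma positive_op_scaleR: "0 \<le> r \<Longrightarrow> positive_op A \<Longrightarrow> positive_op (r *\<^sub>R A)"
  by (simp add: positive_op_def complex_nonneg_Reals_iff bop_apply_simps cinner_scaleR_right)

lemma positive_op_zero: "positive_op 0"
  by (simp add: positive_op_def bop_apply_simps)

lemma positive_op_conjugate: "positive_op A \<Longrightarrow> positive_op (T * A * adj T)"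
  unfolding positive_op_def bop_apply_simps by (metis adj_simps(1) cinner_adj_right)

lemma positive_op_self_mult_adj: "positive_op (T * adj T)"
  by (simp add: positive_op_def bop_apply_simps cinner_adj_left[symmetric] cinner_self)

lemma positive_op_sum: "(\<And>i. i \<in> I \<Longrightarrow> positive_op (f i)) \<Longrightarrow> positive_op (\<Sum>i\<in>I. f i)"
  by (induction I rule: infinite_finite_induct) (simp_all add: positive_op_zero positive_op_add)

lemma positive_op_suminf:
  assumes "summable f" "\<And>n. positive_op (f n)"
  shows "positive_op (suminf f)"
  unfolding positive_op_def
proof
  fix x
  have lim: "(\<lambda>n. cinner x (bop_apply (sum f {..<n}) x)) \<longlonglongrightarrow> cinner x (bop_apply (suminf f) x)"
    by (intro tendsto_cinner tendsto_const bop.tendsto summable_LIMSEQ assms)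
  have "cinner x (bop_apply (sum f {..<n}) x) \<in> \<real>\<^sub>\<ge>\<^sub>0" for n
    using positive_op_sum[of "{..<n}" f] assms(2) by (simp add: positive_op_def)
  then show "cinner x (bop_apply (suminf f) x) \<in> \<real>\<^sub>\<ge>\<^sub>0"
    by (rule closed_sequentially[OF closed_nonneg_Reals_complex _ lim])
qed

text \<open>Evaluate the form at \<open>x\<close> minus \<open>B x\<close> divided by
  \<open>norm B\<close>. The estimate turns smallness of the form at \<open>x\<close> into smallness
  of \<open>B x\<close>, which uniqueness of square roots relies on.\<close>

lemma positive_op_norm_squared_le:
  assumes "positive_op B"
  shows "(norm (bop_apply B x))\<^sup>2 \<le> norm B * Re (cinner x (bop_apply B x))"
proof (cases "norm B = 0")
  case False
  then have pos: "norm B > 0" by simp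
  let ?s = "inverse (norm B)" and ?y = "bop_apply B x"
  have sa: "cinner ?y z = cinner x (bop_apply B z)" for z
    using cinner_adj_left[of B x z] positive_op_selfadjoint[OF assms] by simp
  have "0 \<le> Re (cinner (x - ?s *\<^sub>R ?y) (bop_apply B (x - ?s *\<^sub>R ?y)))"
    by (rule positive_opD[OF assms])
  also have "\<dots> = Re (cinner x ?y) - 2 * ?s * Re (cinner ?y ?y) + ?s\<^sup>2 * Re (cinner ?y (bop_apply B ?y))"
    by (simp add: bop.diff_right bop.scaleR_right cinner_diff_left cinner_diff_right
        cinner_scaleR_left cinner_scaleR_right sa power2_eq_square algebra_simps)
  also have "Re (cinner ?y (bop_apply B ?y)) \<le> norm B * (norm ?y)\<^sup>2"
  proof -
    have "Re (cinner ?y (bop_apply B ?y)) \<le> norm ?y * norm (bop_apply B ?y)"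
      using cinner_Cauchy_Schwarz complex_Re_le_cmod order_trans by blast
    also have "\<dots> \<le> norm ?y * (norm B * norm ?y)"
      by (intro mult_left_mono norm_bop_apply) simp
    finally show ?thesis by (simp add: power2_eq_square mult_ac)
  qed
  finally have "0 \<le> Re (cinner x ?y) - 2 * ?s * (norm ?y)\<^sup>2 + ?s\<^sup>2 * (norm B * (norm ?y)\<^sup>2)"
    by (simp add: cinner_self mult_left_mono)
  also have "\<dots> = Re (cinner x ?y) - ?s * (norm ?y)\<^sup>2"
    using pos by (simp add: power2_eq_square field_simps)
  finally show ?thesis using pos by (simp add: field_simps)
qed (use norm_bop_apply[of B x] in simp)

text \<open>An operator norm need not be attained, so the eigenvector argument for square roots has
  to run along a sequence.\<close>

lemma almost_norming_vectors:
  fixes X :: "'h::complex_hilbert_space bop"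
  assumes "X \<noteq> 0"
  obtains x where "\<And>n. norm (x n) = 1" "(\<lambda>n. norm (bop_apply X (x n))) \<longlonglongrightarrow> norm X"
proof -
  have "\<exists>x. norm x = 1 \<and> norm X - inverse (Suc n) < norm (bop_apply X x)" for n
  proof (rule ccontr)
    assume neg: "\<nexists>x. norm x = 1 \<and> norm X - inverse (Suc n) < norm (bop_apply X x)"
    let ?K = "max 0 (norm X - inverse (Suc n))"
    have "norm X \<le> ?K"
    proof (rule norm_bop_bound)
      fix x
      show "norm (bop_apply X x) \<le> ?K * norm x"
      proof (cases "x = 0")
        case False
        then have "norm (sgn x) = 1" by (simp add: norm_sgn)
        then have "norm (bop_apply X (sgn x)) \<le> ?K" using neg by force
        moreover have "norm (bop_apply X (sgn x)) = norm (bop_apply X x) / norm x"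
          by (simp add: sgn_div_norm bop.scaleR_right divide_inverse mult.commute)
        ultimately show ?thesis using False by (simp add: divide_le_eq)
      qed (simp add: bop.zero_right)
    qed simp
    moreover have "norm X > 0" "inverse (real (Suc n)) > 0" using assms by simp_all
    ultimately show False by linarith
  qed
  then obtain x where x: "\<And>n. norm (x n) = 1"
      "\<And>n. norm X - inverse (Suc n) < norm (bop_apply X (x n))"
    by metis
  have "(\<lambda>n. norm (bop_apply X (x n))) \<longlonglongrightarrow> norm X"
  proof (rule tendsto_sandwich)
    show "(\<lambda>n. norm X - inverse (Suc n)) \<longlonglongrightarrow> norm X"
      using tendsto_diff[OF tendsto_const LIMSEQ_inverse_real_of_nat] by fastforce
    show "(\<lambda>n. norm X) \<longlonglongrightarrow> norm X" by simp
    show "\<forall>\<^sub>F n in sequentially. norm X - inverse (Suc n) \<le> norm (bop_apply X (x n))"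
      using x(2) by (simp add: less_imp_le)
    show "\<forall>\<^sub>F n in sequentially. norm (bop_apply X (x n)) \<le> norm X"
      using norm_bop_apply[of X] x(1) by (metis (no_types, lifting) eventuallyI mult.right_neutral)
  qed
  with x(1) that show thesis by blast
qed

text \<open>With \<open>X = B - D\<close> and \<open>Y = B + D\<close>, the hypothesis says \<open>XY = -YX\<close>, so \<open>X\<^sup>2Y = -XYX \<le> 0\<close>.
  On unit vectors \<open>x\<^sub>n\<close> almost attaining the norm of \<open>X\<close>, the operator \<open>X\<^sup>2\<close> acts almost as
  \<open>\<parallel>X\<parallel>\<^sup>2\<close>, which forces \<open>\<langle>x\<^sub>n, Y x\<^sub>n\<rangle> \<rightarrow> 0\<close>, hence \<open>B x\<^sub>n \<rightarrow> 0\<close> and \<open>D x\<^sub>n \<rightarrow> 0\<close>.\<close>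

theorem positive_sqrt_unique:
  assumes B: "positive_op B" and D: "positive_op D" and eq: "B * B = D * D"
  shows "B = D"
proof (rule ccontr)
  assume "B \<noteq> D"
  define X where "X = B - D"
  define Y where "Y = B + D"
  define L where "L = norm X"
  have "X \<noteq> 0" using \<open>B \<noteq> D\<close> by (simp add: X_def)
  then have L: "L > 0" by (simp add: L_def)
  obtain x where x1: "\<And>n. norm (x n) = 1" and xL: "(\<lambda>n. norm (bop_apply X (x n))) \<longlonglongrightarrow> L"
    using almost_norming_vectors[OF \<open>X \<noteq> 0\<close>] unfolding L_def by blast
  have Xsa: "adj X = X"
    using B D by (simp add: X_def positive_op_selfadjoint)
  have Ypos: "positive_op Y" using B D by (simp add: Y_def positive_op_add)
  have XY: "X * Y = - (Y * X)"
    using eq by (simp add: X_def Y_def algebra_simps)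
  have XXY: "X * X * Y = - (X * Y * X)"
    using XY by (metis minus_mult_right mult.assoc)
  \<comment> \<open>\<open>z n\<close> measures how far \<open>x n\<close> is from being an
    eigenvector of \<open>X * X\<close> with eigenvalue \<open>L\<^sup>2\<close>.\<close>
  define z where "z n = L\<^sup>2 *\<^sub>R x n - bop_apply (X * X) (x n)" for n
  define q where "q n = Re (cinner (x n) (bop_apply Y (x n)))" for n
  have z_bound: "(norm (z n))\<^sup>2 \<le> L\<^sup>2 * (L\<^sup>2 - (norm (bop_apply X (x n)))\<^sup>2)" for n
  proof -
    have "Re (cinner (L\<^sup>2 *\<^sub>R x n) (bop_apply (X * X) (x n))) = L\<^sup>2 * (norm (bop_apply X (x n)))\<^sup>2"
      using norm_bop_apply_squared[of X "x n"] by (simp add: Xsa cinner_scaleR_left)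
    then have "(norm (z n))\<^sup>2 = (L\<^sup>2)\<^sup>2 - 2 * (L\<^sup>2 * (norm (bop_apply X (x n)))\<^sup>2)
        + (norm (bop_apply (X * X) (x n)))\<^sup>2"
      unfolding z_def norm_diff_squared by (simp add: x1)
    moreover have "(norm (bop_apply (X * X) (x n)))\<^sup>2 \<le> (L * norm (bop_apply X (x n)))\<^sup>2"
      unfolding L_def bop_apply_simps by (intro power_mono norm_bop_apply) simp
    ultimately show ?thesis
      by (simp add: power_mult_distrib power2_eq_square algebra_simps)
  qed
  have "(\<lambda>n. L\<^sup>2 * (L\<^sup>2 - (norm (bop_apply X (x n)))\<^sup>2)) \<longlonglongrightarrow> L\<^sup>2 * (L\<^sup>2 - L\<^sup>2)"
    by (intro tendsto_intros xL)
  then have "(\<lambda>n. L\<^sup>2 * (L\<^sup>2 - (norm (bop_apply X (x n)))\<^sup>2)) \<longlonglongrightarrow> 0" by simp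
  then have "(\<lambda>n. (norm (z n))\<^sup>2) \<longlonglongrightarrow> 0"
    by (rule Lim_null_comparison[rotated]) (simp add: z_bound)
  then have "(\<lambda>n. sqrt ((norm (z n))\<^sup>2)) \<longlonglongrightarrow> sqrt 0" by (rule tendsto_real_sqrt)
  then have z0: "(\<lambda>n. norm (z n)) \<longlonglongrightarrow> 0" by simp
  have q_bound: "q n \<le> norm (z n) * norm Y / L\<^sup>2" for n
  proof -
    have "cinner (bop_apply (X * X) (x n)) (bop_apply Y (x n)) = cinner (x n) (bop_apply (X * X * Y) (x n))"
      using cinner_adj_left[of "X * X"] by (simp add: Xsa bop_apply_simps)
    also have "\<dots> = - cinner (bop_apply X (x n)) (bop_apply Y (bop_apply X (x n)))"
      \<comment> \<open>\<open>cinner_diff_right\<close> at 0 supplies the rule for a minus sign in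
        the second argument.\<close>
      unfolding XXY using cinner_adj_left[of X]
      by (simp add: Xsa bop_apply_simps cinner_diff_right[of _ 0, simplified])
    finally have "Re (cinner (bop_apply (X * X) (x n)) (bop_apply Y (x n))) \<le> 0"
      using positive_opD[OF Ypos, of "bop_apply X (x n)"] by simp
    moreover have "L\<^sup>2 * q n = Re (cinner (z n) (bop_apply Y (x n)))
        + Re (cinner (bop_apply (X * X) (x n)) (bop_apply Y (x n)))"
      by (simp add: q_def z_def cinner_diff_left cinner_scaleR_left)
    moreover have "Re (cinner (z n) (bop_apply Y (x n))) \<le> norm (z n) * norm Y"
    proof -
      have "Re (cinner (z n) (bop_apply Y (x n))) \<le> norm (z n) * norm (bop_apply Y (x n))"
        using cinner_Cauchy_Schwarz complex_Re_le_cmod order_trans by blast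
      also have "\<dots> \<le> norm (z n) * norm Y"
        using norm_bop_apply[of Y "x n"] x1[of n] by (intro mult_left_mono) auto
      finally show ?thesis .
    qed
    ultimately have "L\<^sup>2 * q n \<le> norm (z n) * norm Y" by linarith
    then show ?thesis using L by (simp add: field_simps)
  qed
  have "(\<lambda>n. norm (z n) * norm Y / L\<^sup>2) \<longlonglongrightarrow> 0 * norm Y / L\<^sup>2"
    using L by (intro tendsto_intros z0) simp
  then have "(\<lambda>n. norm (z n) * norm Y / L\<^sup>2) \<longlonglongrightarrow> 0" by simp
  then have q0: "q \<longlonglongrightarrow> 0"
  proof (rule Lim_null_comparison[rotated])
    have "0 \<le> q n" for n by (simp add: q_def positive_opD[OF Ypos])
    then show "\<forall>\<^sub>F n in sequentially. norm (q n) \<le> norm (z n) * norm Y / L\<^sup>2"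
      by (simp add: q_bound)
  qed
  have null: "(\<lambda>n. norm (bop_apply T (x n))) \<longlonglongrightarrow> 0"
    if T: "positive_op T" "\<And>n. Re (cinner (x n) (bop_apply T (x n))) \<le> q n" for T
  proof -
    have "(norm (bop_apply T (x n)))\<^sup>2 \<le> norm T * q n" for n
      using positive_op_norm_squared_le[OF T(1), of "x n"] T(2)[of n]
      by (meson mult_left_mono norm_ge_zero order_trans)
    then have le: "\<forall>\<^sub>F n in sequentially. norm ((norm (bop_apply T (x n)))\<^sup>2) \<le> norm T * q n"
      by simp
    have "(\<lambda>n. norm T * q n) \<longlonglongrightarrow> 0"
      using tendsto_mult[OF tendsto_const q0, of "norm T"] by simp
    then have "(\<lambda>n. (norm (bop_apply T (x n)))\<^sup>2) \<longlonglongrightarrow> 0"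
      by (rule Lim_null_comparison[OF le])
    then have "(\<lambda>n. sqrt ((norm (bop_apply T (x n)))\<^sup>2)) \<longlonglongrightarrow> sqrt 0" by (rule tendsto_real_sqrt)
    then show ?thesis by simp
  qed
  have "q n = Re (cinner (x n) (bop_apply B (x n))) + Re (cinner (x n) (bop_apply D (x n)))" for n
    by (simp add: q_def Y_def bop_apply_simps cinner_add_right)
  then have "(\<lambda>n. norm (bop_apply B (x n)) + norm (bop_apply D (x n))) \<longlonglongrightarrow> 0 + 0"
    using positive_opD[OF B] positive_opD[OF D] by (intro tendsto_add null B D) auto
  then have "(\<lambda>n. norm (bop_apply X (x n))) \<longlonglongrightarrow> 0"
    unfolding X_def bop_apply_simps add_0
    by (rule Lim_null_comparison[rotated]) (simp add: norm_triangle_ineq4)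
  then show False using LIMSEQ_unique[OF xL] L by simp
qed

lemma op_sqrt_eqI: "positive_op B \<Longrightarrow> B * B = A \<Longrightarrow> op_sqrt A = B"
  unfolding op_sqrt_def using positive_sqrt_unique by (intro the_equality) auto

section \<open>Kernels, ranges and the polar decomposition\<close>

lemma closed_op_ker: "closed (op_ker A)"
  unfolding op_ker_def
  by (intro closed_Collect_eq continuous_on_const) (rule bop.continuous_on[OF continuous_on_const continuous_on_id])

lemma csubspace_op_ker: "csubspace (op_ker A)"
  by (simp add: csubspace_def op_ker_def bop.add_right bop.zero_right bop_apply_scaleC)

lemma csubspace_range: "csubspace (range (bop_apply A))"
proof -
  have "0 = bop_apply A 0" by (simp add: bop.zero_right)
  moreover have "bop_apply A u + bop_apply A v = bop_apply A (u + v)" for u v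
    by (simp add: bop.add_right)
  moreover have "c *\<^sub>C bop_apply A u = bop_apply A (c *\<^sub>C u)" for c u
    by (simp add: bop_apply_scaleC)
  ultimately show ?thesis
    unfolding csubspace_def by (auto intro!: range_eqI)
qed

lemma selfadjoint_ortho_range:
  assumes "adj C = C" "\<And>u. cinner (bop_apply C u) n = 0"
  shows "bop_apply C n = 0"
  using cinner_adj_left[of C "bop_apply C n" n] assms
  by (metis cinner_self_eq_0 cinner_adj_right)

text \<open>Split off from \<open>x\<close> its projection onto the kernel of \<open>W\<close>,
  which contains the range of \<open>C\<close>. The rest is orthogonal to that range, hence in the
  kernel of the selfadjoint \<open>C\<close>, hence again in the kernel of \<open>W\<close>.\<close>

lemma zero_on_range_and_kernel:
  assumes "adj C = C" "W * C = 0" "op_ker C \<subseteq> op_ker W"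
  shows "W = 0"
proof (rule bop_eqI)
  fix x
  obtain m where m: "m \<in> op_ker W" "\<And>y. y \<in> op_ker W \<Longrightarrow> cinner y (x - m) = 0"
    using orthogonal_projection_exists[OF csubspace_op_ker closed_op_ker] by blast
  have "bop_apply C u \<in> op_ker W" for u
    using assms(2) by (simp add: op_ker_def bop_apply_simps(6)[symmetric]) (simp add: bop_apply_simps)
  then have "x - m \<in> op_ker C"
    using selfadjoint_ortho_range[OF assms(1)] m(2) by (simp add: op_ker_def)
  then have "bop_apply W (x - m) = 0" using assms(3) by (auto simp: op_ker_def)
  then show "bop_apply W x = bop_apply 0 x"
    using m(1) by (simp add: op_ker_def bop.diff_right bop_apply_simps)
qed

text \<open>The hypothesis \<open>CC\<close> makes the images of a vector under \<open>C\<close> and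
  \<open>adj a\<close> equally long, so sending the first to the second is isometric on the range of
  \<open>C\<close>. \<open>V\<close> extends this to the closure and is zero on the kernel of
  \<open>C\<close>.\<close>

theorem polar_decomposition_exists:
  fixes a C :: "'h::complex_hilbert_space bop"
  assumes Csa: "adj C = C" and CC: "C * C = a * adj a"
  shows "\<exists>V. partial_isometry V \<and> adj a = V * C \<and> op_ker V = op_ker C"
proof -
  let ?C = "bop_apply C" and ?a = "bop_apply (adj a)"
  have norm_eq: "norm (?a x) = norm (?C x)" for x
    by (rule power2_eq_imp_eq) (simp_all add: norm_bop_apply_squared Csa CC)
  \<comment> \<open>\<open>m\<close> stands for the projection of \<open>x\<close> onto the closure
    of the range of \<open>C\<close>, and \<open>v\<close> for the value of \<open>V\<close> at
    \<open>x\<close>, reached along preimages \<open>u k\<close>. \<open>R_unique\<close> shows that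
    \<open>v\<close> does not depend on the preimages.\<close>
  define R where "R x m v \<longleftrightarrow>
      (\<exists>u. (\<lambda>k. ?C (u k)) \<longlonglongrightarrow> m \<and> (\<lambda>k. ?a (u k)) \<longlonglongrightarrow> v) \<and> ?C (x - m) = 0" for x m v
  have R_I: "R x m v"
    if "(\<lambda>k. ?C (u k)) \<longlonglongrightarrow> m" "(\<lambda>k. ?a (u k)) \<longlonglongrightarrow> v" "?C (x - m) = 0" for x m v u
    unfolding R_def using that by (intro conjI exI[of _ u])
  have R_norm: "norm v = norm m" if "R x m v" for x m v
  proof -
    obtain u where m: "(\<lambda>k. ?C (u k)) \<longlonglongrightarrow> m" and v: "(\<lambda>k. ?a (u k)) \<longlonglongrightarrow> v"
      using \<open>R x m v\<close> R_def by blast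
    show ?thesis
      using tendsto_norm[OF v] unfolding norm_eq by (rule LIMSEQ_unique[OF _ tendsto_norm[OF m]])
  qed
  have R_ortho: "cinner n m = 0" if "R x m v" "?C n = 0" for x m v n
  proof -
    obtain u where u: "(\<lambda>k. ?C (u k)) \<longlonglongrightarrow> m" using \<open>R x m v\<close> R_def by blast
    have "cinner n (?C (u k)) = 0" for k
      using cinner_adj_left[of C n "u k"] that(2) by (simp add: Csa)
    then have "(\<lambda>k. 0) \<longlonglongrightarrow> cinner n m"
      using tendsto_cinner[OF tendsto_const u, of n] by simp
    then show ?thesis by (rule LIMSEQ_unique) simp
  qed
  have R_le: "norm v \<le> norm x" if "R x m v" for x m v
  proof -
    have "cinner (x - m) m = 0" using R_ortho[OF that] that by (simp add: R_def)
    then have "(norm (x - m + m))\<^sup>2 = (norm (x - m))\<^sup>2 + (norm m)\<^sup>2"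
      unfolding norm_add_squared by simp
    then have "(norm m)\<^sup>2 \<le> (norm x)\<^sup>2" by simp
    then have "norm m \<le> norm x" by (rule power2_le_imp_le) simp
    then show ?thesis unfolding R_norm[OF that] .
  qed
  have R_add: "R (x + x') (m + m') (v + v')" if R: "R x m v" "R x' m' v'" for x m v x' m' v'
  proof -
    obtain u u' where "(\<lambda>k. ?C (u k)) \<longlonglongrightarrow> m" "(\<lambda>k. ?a (u k)) \<longlonglongrightarrow> v"
      "(\<lambda>k. ?C (u' k)) \<longlonglongrightarrow> m'" "(\<lambda>k. ?a (u' k)) \<longlonglongrightarrow> v'" using R unfolding R_def by blast
    then have "(\<lambda>k. ?C (u k + u' k)) \<longlonglongrightarrow> m + m'" "(\<lambda>k. ?a (u k + u' k)) \<longlonglongrightarrow> v + v'"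
      unfolding bop.add_right by (auto intro: tendsto_add)
    moreover have "?C (x + x' - (m + m')) = 0"
      using that by (simp add: R_def bop.add_right bop.diff_right)
    ultimately show ?thesis by (rule R_I)
  qed
  have R_scale: "R (c *\<^sub>C x) (c *\<^sub>C m) (c *\<^sub>C v)" if R: "R x m v" for x m v c
  proof -
    obtain u where "(\<lambda>k. ?C (u k)) \<longlonglongrightarrow> m" "(\<lambda>k. ?a (u k)) \<longlonglongrightarrow> v" using R unfolding R_def by blast
    then have "(\<lambda>k. ?C (c *\<^sub>C u k)) \<longlonglongrightarrow> c *\<^sub>C m" "(\<lambda>k. ?a (c *\<^sub>C u k)) \<longlonglongrightarrow> c *\<^sub>C v"
      unfolding bop_apply_scaleC by (auto intro: tendsto_scaleC)
    moreover have "?C (c *\<^sub>C x - c *\<^sub>C m) = 0"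
      using that by (simp add: R_def scaleC_diff_right[symmetric] bop_apply_scaleC)
    ultimately show ?thesis by (rule R_I)
  qed
  have R_unique: "v = v'" if "R x m v" "R x m' v'" for x m v m' v'
  proof -
    have neg: "(-1) *\<^sub>C y = - y" for y :: 'h
      using scaleR_scaleC[of "-1" y] by simp
    have "R (x + - x) (m + (-1) *\<^sub>C m') (v + (-1) *\<^sub>C v')"
      using R_add[OF that(1) R_scale[OF that(2), of "-1"]] by (simp add: neg)
    from R_le[OF this] show ?thesis by (simp add: neg)
  qed
  have "\<exists>m v. R x m v" for x
  proof -
    obtain m where m: "m \<in> closure (range ?C)" "\<And>y. y \<in> closure (range ?C) \<Longrightarrow> cinner y (x - m) = 0"
      using orthogonal_projection_exists[OF csubspace_closure[OF csubspace_range] closed_closure] by blast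
    have "?C u \<in> closure (range ?C)" for u
      using closure_subset[of "range ?C"] by blast
    then have "cinner (?C u) (x - m) = 0" for u by (rule m(2))
    then have 1: "?C (x - m) = 0" by (rule selfadjoint_ortho_range[OF Csa])
    obtain w where w: "\<And>k. w k \<in> range ?C" "w \<longlonglongrightarrow> m" using m(1) unfolding closure_sequential by blast
    then have "\<exists>u. \<forall>k. w k = ?C (u k)" by (intro choice) blast
    then obtain u where u: "\<And>k. w k = ?C (u k)" by blast
    \<comment> \<open>Equal lengths carry the Cauchy property from the images under \<open>C\<close>
      to those under \<open>adj a\<close>.\<close>
    have "dist (?a (u k)) (?a (u l)) = dist (w k) (w l)" for k l
      unfolding dist_norm u bop.diff_right[symmetric] by (rule norm_eq)
    then have "Cauchy (\<lambda>k. ?a (u k))"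
      using LIMSEQ_imp_Cauchy[OF w(2)] by (simp add: Cauchy_def)
    then obtain v where "(\<lambda>k. ?a (u k)) \<longlonglongrightarrow> v"
      using Cauchy_convergent convergent_def by blast
    then show ?thesis using R_I[OF w(2)[unfolded u] _ 1] by blast
  qed
  then obtain M f where Mf: "\<And>x. R x (M x) (f x)" by metis
  have "\<exists>V. bop_apply V = f"
    using R_unique[OF Mf R_add[OF Mf Mf]] R_unique[OF Mf R_scale[OF Mf]] R_le[OF Mf]
    by (intro bop_exists[where K = 1]) simp_all
  then obtain V where V: "bop_apply V = f" by blast
  have "f (?C x) = ?a x" for x
  proof -
    have "R (?C x) (?C x) (?a x)" by (rule R_I[of "\<lambda>_. x"]) (simp_all add: bop.zero_right)
    then show ?thesis using R_unique Mf by blast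
  qed
  then have "adj a = V * C" by (intro bop_eqI) (simp add: bop_apply_simps V)
  moreover have kers: "op_ker V = op_ker C"
  proof -
    have "f x = 0 \<longleftrightarrow> ?C x = 0" for x
    proof
      assume "f x = 0"
      then have "M x = 0" using R_norm[OF Mf[of x]] by simp
      then show "?C x = 0" using Mf[of x] by (simp add: R_def)
    next
      assume "?C x = 0"
      then have "R x 0 0" by (intro R_I[of "\<lambda>_. 0"]) (simp_all add: bop.zero_right)
      then show "f x = 0" using R_unique Mf by blast
    qed
    then show ?thesis by (simp add: op_ker_def V)
  qed
  moreover have "partial_isometry V"
    unfolding partial_isometry_def
  proof (intro allI impI)
    fix x assume x: "\<forall>y\<in>op_ker V. cinner y x = 0"
    have C0: "?C (x - M x) = 0" using Mf[of x] by (simp add: R_def)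
    then have "x - M x \<in> op_ker V" unfolding kers by (simp add: op_ker_def)
    then have "cinner (x - M x) x = 0" using x by blast
    moreover have "cinner (x - M x) (M x) = 0" using R_ortho[OF Mf C0] .
    ultimately have "cinner (x - M x) (x - M x) = 0" by (simp add: cinner_diff_right)
    then have "x = M x" by simp
    then show "norm (bop_apply V x) = norm x" using R_norm[OF Mf[of x]] V by simp
  qed
  ultimately show ?thesis by blast
qed

text \<open>Resolves both definite descriptions: a positive \<open>C\<close> with the right square
  is the root, and two candidates for the partial isometry agree on the range of \<open>C\<close>
  and on its kernel.\<close>

lemma polar_S_properties:
  fixes a C :: "'h::complex_hilbert_space bop"
  assumes C: "positive_op C" and CC: "C * C = a * adj a"
  shows "adj a = adj (polar_S a) * C" "op_ker (adj (polar_S a)) = op_ker C"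
proof -
  note Csa = positive_op_selfadjoint[OF C]
  let ?P = "\<lambda>V. partial_isometry V \<and> adj a = V * C \<and> op_ker V = op_ker C"
  have "V = V'" if "?P V" "?P V'" for V V'
  proof -
    have "V * C = adj a" "V' * C = adj a" using that by simp_all
    then have "(V - V') * C = 0" by (simp add: left_diff_distrib)
    moreover have "op_ker C \<subseteq> op_ker (V - V')"
    proof
      fix x assume "x \<in> op_ker C"
      then have "x \<in> op_ker V" "x \<in> op_ker V'" using that by simp_all
      then show "x \<in> op_ker (V - V')" by (simp add: op_ker_def bop_apply_simps)
    qed
    ultimately have "V - V' = 0" by (rule zero_on_range_and_kernel[OF Csa])
    then show ?thesis by simp
  qed
  then have "\<exists>!V. ?P V" using polar_decomposition_exists[OF Csa CC] by blast
  then have "?P (The ?P)" by (rule theI')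
  moreover have "adj (polar_S a) = The ?P"
    unfolding polar_S_def Let_def op_sqrt_eqI[OF C CC] by (rule adj_simps(1))
  ultimately have "?P (adj (polar_S a))" by (simp only:)
  then show "adj a = adj (polar_S a) * C" "op_ker (adj (polar_S a)) = op_ker C"
    by blast+
qed

section \<open>Amplification along a partial isometry\<close>

text \<open>One series covers both constructions: weight \<mu> leads from one \<open>a_stage\<close>
  to the next, and weight \<open>\<mu>\<^sup>2\<close> with \<open>X = t * adj t\<close> gives the
  operator under the square root.\<close>

definition amplify :: "real \<Rightarrow> 'h::complex_hilbert_space bop \<Rightarrow> 'h bop \<Rightarrow> 'h bop" where
  "amplify \<nu> t X = (\<Sum>n. \<nu> ^ n *\<^sub>R (t ^ n * X * adj t ^ n))"

lemma power_conjugate_Suc: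
  fixes t :: "'h::complex_hilbert_space bop"
  shows "t ^ Suc n * X * s ^ Suc n = t * (t ^ n * X * s ^ n) * s"
  by (simp add: mult.assoc power_commutes)

lemma norm_contraction_mult_le:
  fixes s t :: "'h::complex_hilbert_space bop"
  assumes "norm t \<le> 1" "norm s \<le> 1"
  shows "norm (t * X * s) \<le> norm X"
proof -
  have "norm (t * X * s) \<le> norm (t * X) * norm s" by (rule norm_mult_ineq)
  also have "\<dots> \<le> norm (t * X)" using assms(2) by (simp add: mult_left_le)
  also have "\<dots> \<le> norm t * norm X" by (rule norm_mult_ineq)
  also have "\<dots> \<le> norm X" using assms(1) by (simp add: mult_left_le_one_le)
  finally show ?thesis .
qed

lemma norm_power_conjugate_le:
  fixes s t :: "'h::complex_hilbert_space bop"
  assumes "norm t \<le> 1" "norm s \<le> 1"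
  shows "norm (t ^ n * X * s ^ n) \<le> norm X"
proof (induction n)
  case (Suc n)
  then show ?case
    unfolding power_conjugate_Suc using norm_contraction_mult_le[OF assms] order_trans by blast
qed simp

locale contraction =
  fixes t :: "'h::complex_hilbert_space bop"
  assumes norm_t: "norm t \<le> 1"
begin

lemma norm_adj_t: "norm (adj t) \<le> 1"
  using norm_adj_le norm_t by (rule order_trans)

lemma summable_weighted_conjugates:
  assumes "summable (\<lambda>n. \<bar>c n\<bar>)"
  shows "summable (\<lambda>n. c n *\<^sub>R (t ^ n * X * adj t ^ n))"
proof (rule summable_comparison_test')
  show "summable (\<lambda>n. \<bar>c n\<bar> * norm X)" using assms by (rule summable_mult2)
  show "norm (c n *\<^sub>R (t ^ n * X * adj t ^ n)) \<le> \<bar>c n\<bar> * norm X" if "0 \<le> n" for n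
    by (simp add: mult_left_mono norm_power_conjugate_le[OF norm_t norm_adj_t])
qed

lemma summable_amplify:
  assumes "\<bar>\<nu>\<bar> < 1"
  shows "summable (\<lambda>n. \<nu> ^ n *\<^sub>R (t ^ n * X * adj t ^ n))"
  using assms by (intro summable_weighted_conjugates) (simp add: power_abs summable_geometric)

text \<open>The term \<open>n = 0\<close> is \<open>X\<close>, and each later term is its
  predecessor conjugated by \<open>t\<close> and scaled by \<nu>.\<close>

lemma amplify_fixpoint:
  assumes "\<bar>\<nu>\<bar> < 1"
  shows "amplify \<nu> t X = X + \<nu> *\<^sub>R (t * amplify \<nu> t X * adj t)"
proof -
  let ?f = "\<lambda>n. \<nu> ^ n *\<^sub>R (t ^ n * X * adj t ^ n)"
  have bl: "bounded_linear (\<lambda>Y. \<nu> *\<^sub>R (t * Y * adj t))"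
    by (intro bounded_linear_scaleR_right[THEN bounded_linear_compose]
        bounded_linear_mult_left[THEN bounded_linear_compose] bounded_linear_mult_right)
  have step: "?f (Suc n) = \<nu> *\<^sub>R (t * ?f n * adj t)" for n
    unfolding power_conjugate_Suc by simp
  have "(\<Sum>n. ?f (Suc n)) = \<nu> *\<^sub>R (t * amplify \<nu> t X * adj t)"
    unfolding step amplify_def
    by (rule bounded_linear.suminf[OF bl summable_amplify[OF assms], symmetric])
  then show ?thesis
    using suminf_split_head[OF summable_amplify[OF assms, of X]] by (simp add: amplify_def)
qed

text \<open>The difference \<open>D\<close> of two solutions satisfies
  \<open>D = \<nu> *\<^sub>R (t * D * adj t)\<close>, so its norm is at most \<bar>\<nu>\<bar> times
  itself.\<close>

lemma amplify_unique:
  assumes "\<bar>\<nu>\<bar> < 1" and Z: "Z = X + \<nu> *\<^sub>R (t * Z * adj t)"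
  shows "amplify \<nu> t X = Z"
proof -
  let ?D = "amplify \<nu> t X - Z"
  have "?D = \<nu> *\<^sub>R (t * ?D * adj t)"
    by (subst amplify_fixpoint[OF assms(1)], subst Z) (simp add: algebra_simps)
  then have "norm ?D = \<bar>\<nu>\<bar> * norm (t * ?D * adj t)" by (metis norm_scaleR)
  also have "\<dots> \<le> \<bar>\<nu>\<bar> * norm ?D"
    by (intro mult_left_mono norm_contraction_mult_le norm_t norm_adj_t) simp
  finally have "(1 - \<bar>\<nu>\<bar>) * norm ?D \<le> 0" by (simp add: algebra_simps)
  then have "norm ?D \<le> 0" using assms(1) by (simp add: mult_le_0_iff)
  then show ?thesis by simp
qed

text \<open>Linearity and, below, compatibility with adjoints come from checking that the candidate
  solves the fixed-point equation.\<close>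

lemma amplify_add:
  "\<bar>\<nu>\<bar> < 1 \<Longrightarrow> amplify \<nu> t (X + Y) = amplify \<nu> t X + amplify \<nu> t Y"
  by (rule amplify_unique, assumption, subst amplify_fixpoint[of \<nu> X], assumption,
      subst amplify_fixpoint[of \<nu> Y], assumption) (simp add: algebra_simps)

lemma amplify_scaleR: "\<bar>\<nu>\<bar> < 1 \<Longrightarrow> amplify \<nu> t (r *\<^sub>R X) = r *\<^sub>R amplify \<nu> t X"
  by (rule amplify_unique, assumption, subst amplify_fixpoint[of \<nu> X], assumption)
    (simp add: algebra_simps)

lemma adj_amplify: "\<bar>\<nu>\<bar> < 1 \<Longrightarrow> adj (amplify \<nu> t X) = amplify \<nu> t (adj X)"
  by (rule amplify_unique[symmetric], assumption, subst amplify_fixpoint[of \<nu> X], assumption)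
    (simp add: mult.assoc)

lemma positive_op_power_conjugate: "positive_op X \<Longrightarrow> positive_op (t ^ n * X * adj t ^ n)"
  using positive_op_conjugate[of X "t ^ n"] by (simp add: adj_power)

lemma positive_op_amplify:
  "0 \<le> \<nu> \<Longrightarrow> \<nu> < 1 \<Longrightarrow> positive_op X \<Longrightarrow> positive_op (amplify \<nu> t X)"
  unfolding amplify_def
  by (intro positive_op_suminf summable_amplify positive_op_scaleR positive_op_power_conjugate) auto

text \<open>Only the head of the series survives; this and its mirror image recover \<open>X\<close>
  from its amplification by compression.\<close>

lemma amplify_left_annihilator:
  "\<bar>\<nu>\<bar> < 1 \<Longrightarrow> A * t = 0 \<Longrightarrow> A * amplify \<nu> t X = A * X"
  by (subst amplify_fixpoint) (simp_all add: distrib_left mult.assoc[symmetric])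

lemma amplify_right_annihilator:
  "\<bar>\<nu>\<bar> < 1 \<Longrightarrow> adj t * A = 0 \<Longrightarrow> amplify \<nu> t X * A = X * A"
  by (subst amplify_fixpoint) (simp_all add: distrib_right mult.assoc)

lemma amplify_left_fixed:
  assumes "\<bar>\<nu>\<bar> < 1" "P * t = t" "P * X = X"
  shows "P * amplify \<nu> t X = amplify \<nu> t X"
  by (subst (1 2) amplify_fixpoint[OF assms(1)]) (simp add: distrib_left mult.assoc[symmetric] assms(2,3))

lemma amplify_right_fixed:
  assumes "\<bar>\<nu>\<bar> < 1" "adj t * P = adj t" "X * P = X"
  shows "amplify \<nu> t X * P = amplify \<nu> t X"
  by (subst (1 2) amplify_fixpoint[OF assms(1)]) (simp add: distrib_right mult.assoc assms(2,3))

end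

section \<open>Isometries of a corner and the diagonal square root\<close>

definition root_weight :: "real \<Rightarrow> nat \<Rightarrow> real" where
  "root_weight \<mu> n = sqrt (\<Sum>k<n. \<mu> ^ (2 * k))"

text \<open>The initial projection \<open>adj t * t\<close> need not be 1, but it fixes the range of
  \<open>t\<close>, so \<open>t\<close> restricts to an isometry of its initial space into
  itself.\<close>

locale corner_isometry =
  fixes t :: "'h::complex_hilbert_space bop"
  assumes partial: "t * adj t * t = t" and range_le: "adj t * t * t = t"
begin

text \<open>As \<open>e = adj t * t\<close> is a projection, the squared norm of \<open>t x\<close>
  is the form of \<open>e\<close> at \<open>x\<close>, hence at most \<open>norm x\<close> times the
  norm of \<open>e x\<close>, which equals the norm of \<open>t x\<close>.\<close>

sublocale contraction
proof
  show "norm t \<le> 1"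
  proof (rule norm_bop_bound)
    fix x
    let ?e = "adj t * t"
    have ee: "adj ?e * ?e = ?e"
      using partial by (simp add: mult.assoc)
    have "(norm (bop_apply ?e x))\<^sup>2 = (norm (bop_apply t x))\<^sup>2"
      unfolding norm_bop_apply_squared ee ..
    then have eq: "norm (bop_apply ?e x) = norm (bop_apply t x)"
      by (simp add: power2_eq_iff_nonneg)
    have "(norm (bop_apply t x))\<^sup>2 \<le> norm x * norm (bop_apply ?e x)"
      unfolding norm_bop_apply_squared
      using cinner_Cauchy_Schwarz complex_Re_le_cmod order_trans by blast
    then show "norm (bop_apply t x) \<le> 1 * norm x"
      unfolding eq by (cases "bop_apply t x = 0") (simp_all add: power2_eq_square)
  qed simp
qed

abbreviation "e \<equiv> adj t * t"

lemma adj_partial: "adj t * (t * adj t) = adj t"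
  using arg_cong[OF partial, of adj] by (simp add: mult.assoc)

lemma adj_range_le: "adj t * e = adj t"
  using arg_cong[OF range_le, of adj] by (simp add: mult.assoc)

lemma t_e: "t * e = t"
  using partial by (simp add: mult.assoc)

lemma e_e: "e * e = e"
  using t_e by (simp add: mult.assoc)

text \<open>Multiply the two fixed-point equations. The mixed terms vanish by the annihilation
  hypotheses, and the \<open>adj t * t\<close> in the last term is absorbed by the right factor, so
  the product solves the equation with weight \<open>\<nu> * \<kappa>\<close>.\<close>

lemma amplify_mult:
  assumes "\<bar>\<nu>\<bar> < 1" "\<bar>\<kappa>\<bar> < 1" and X: "X * t = 0" and Y: "adj t * Y = 0" "e * Y = Y"
  shows "amplify \<nu> t X * amplify \<kappa> t Y = amplify (\<nu> * \<kappa>) t (X * Y)"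
proof (rule amplify_unique[symmetric])
  show "\<bar>\<nu> * \<kappa>\<bar> < 1"
    using abs_mult_less[OF assms(1,2)] by (simp add: abs_mult)
  let ?Z = "amplify \<nu> t X" and ?W = "amplify \<kappa> t Y"
  have "e * t = t" using range_le .
  then have eW: "e * ?W = ?W" by (rule amplify_left_fixed[OF assms(2) _ Y(2)])
  have "?Z * ?W = (X + \<nu> *\<^sub>R (t * ?Z * adj t)) * (Y + \<kappa> *\<^sub>R (t * ?W * adj t))"
    using amplify_fixpoint[OF assms(1), of X] amplify_fixpoint[OF assms(2), of Y] by simp
  also have "\<dots> = X * Y + \<kappa> *\<^sub>R (X * t * ?W * adj t) + \<nu> *\<^sub>R (t * ?Z * (adj t * Y))
      + (\<nu> * \<kappa>) *\<^sub>R (t * ?Z * (e * ?W) * adj t)"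
    by (simp add: algebra_simps)
  also have "\<dots> = X * Y + (\<nu> * \<kappa>) *\<^sub>R (t * (?Z * ?W) * adj t)"
    unfolding X Y(1) eW by (simp add: mult.assoc)
  finally show "?Z * ?W = X * Y + (\<nu> * \<kappa>) *\<^sub>R (t * (?Z * ?W) * adj t)" .
qed

text \<open>\<open>adj t\<close> kills the head, and in the tail \<open>adj t * t\<close> is
  absorbed by the amplified operator.\<close>

lemma adj_t_amplify:
  assumes "\<bar>\<nu>\<bar> < 1" "adj t * Y = 0" "e * Y = Y"
  shows "adj t * amplify \<nu> t Y = \<nu> *\<^sub>R (amplify \<nu> t Y * adj t)"
proof -
  have eW: "e * amplify \<nu> t Y = amplify \<nu> t Y" by (rule amplify_left_fixed[OF assms(1) range_le assms(3)])
  have "adj t * amplify \<nu> t Y = adj t * Y + \<nu> *\<^sub>R (e * amplify \<nu> t Y * adj t)"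
    by (subst amplify_fixpoint[OF assms(1)]) (simp add: distrib_left mult.assoc)
  then show ?thesis by (simp only: eW assms(2) add_0)
qed

lemma amplify_t:
  assumes "\<bar>\<nu>\<bar> < 1" "Y * t = 0" "Y * e = Y"
  shows "amplify \<nu> t Y * t = \<nu> *\<^sub>R (t * amplify \<nu> t Y)"
proof -
  have "adj t * adj Y = 0" "e * adj Y = adj Y"
    using arg_cong[OF assms(2), of adj] arg_cong[OF assms(3), of adj] by simp_all
  from arg_cong[OF adj_t_amplify[OF assms(1) this], of adj]
  show ?thesis using assms(1) by (simp add: adj_amplify)
qed

text \<open>This is the range projection of \<open>t ^ Suc n\<close>, written in the shape of a term
  of \<open>amplify\<close>.\<close>

definition rproj :: "nat \<Rightarrow> 'h bop" where
  "rproj n = t ^ n * (t * adj t) * adj t ^ n"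

text \<open>The projections \<open>rproj n\<close> decrease, so a weighted sum of them is diagonal with the partial
  sums of the weights as eigenvalues; the weights here make these the \<open>root_weight\<close>s.\<close>

definition diag_sqrt :: "real \<Rightarrow> 'h bop" where
  "diag_sqrt \<mu> = (\<Sum>n. (root_weight \<mu> (Suc n) - root_weight \<mu> n) *\<^sub>R rproj n)"

abbreviation "diag_square \<mu> \<equiv> amplify (\<mu>\<^sup>2) t (t * adj t)"

lemma rproj_Suc: "rproj (Suc n) = t * rproj n * adj t"
  unfolding rproj_def by (rule power_conjugate_Suc)

lemma adj_t_rproj: "adj t * rproj (Suc n) = rproj n * adj t"
proof -
  have "e * rproj n = rproj n"
    unfolding rproj_def by (cases n) (simp_all add: mult.assoc[symmetric] range_le)
  then show ?thesis by (simp add: rproj_Suc mult.assoc[symmetric])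
qed

lemma rproj_0_left: "rproj 0 * rproj n = rproj n"
  unfolding rproj_def by (cases n) (simp_all add: mult.assoc[symmetric] partial)

lemma rproj_0_right: "rproj n * rproj 0 = rproj n"
  unfolding rproj_def
  by (cases n) (simp_all add: mult.assoc power_commutes[of "adj t", symmetric] adj_partial)

text \<open>A product of two such projections with positive indices is the conjugate by
  \<open>t\<close> of the product with both indices lowered by one.\<close>

lemma rproj_mult_le: "m \<le> n \<Longrightarrow> rproj m * rproj n = rproj n \<and> rproj n * rproj m = rproj n"
proof (induction m arbitrary: n)
  case 0
  then show ?case by (simp add: rproj_0_left rproj_0_right)
next
  case (Suc m)
  then obtain k where n: "n = Suc k" by (cases n) auto
  have "rproj (Suc j) * rproj (Suc l) = t * (rproj j * rproj l) * adj t" for j l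
    by (subst rproj_Suc) (simp add: mult.assoc adj_t_rproj)
  then show ?case using Suc.IH[of k] Suc.prems by (simp add: n rproj_Suc[symmetric])
qed

lemma positive_op_rproj: "positive_op (rproj n)"
  unfolding rproj_def by (intro positive_op_power_conjugate positive_op_self_mult_adj)

context
  fixes \<mu> :: real
  assumes \<mu>: "\<bar>\<mu>\<bar> < 1"
begin

lemma sq_less_1: "\<bar>\<mu>\<^sup>2\<bar> < 1"
  using \<mu> by (simp add: abs_square_less_1)

text \<open>Positivity and summability of \<open>diag_sqrt\<close> rest on these. As
  \<open>root_weight \<mu> (Suc n)\<close> is at least 1, a difference of roots is bounded by the
  difference of their squares.\<close>

lemma root_weight_diff_bounds:
  "0 \<le> root_weight \<mu> (Suc n) - root_weight \<mu> n"
  "root_weight \<mu> (Suc n) - root_weight \<mu> n \<le> (\<mu>\<^sup>2) ^ n"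
proof -
  let ?c = "\<lambda>n. \<Sum>k<n. \<mu> ^ (2 * k)" and ?s = "root_weight \<mu>"
  have c0: "?c n \<ge> 0" for n by (intro sum_nonneg) simp
  have p0: "0 \<le> \<mu> ^ (2 * n)" by simp
  have "0 \<le> (\<Sum>k<n. \<mu> ^ (2 * Suc k))" by (intro sum_nonneg zero_le_even_power) simp
  then have "?c (Suc n) \<ge> 1" unfolding sum.lessThan_Suc_shift by simp
  then have s1: "?s (Suc n) \<ge> 1" by (simp add: root_weight_def)
  show mono: "0 \<le> ?s (Suc n) - ?s n" using p0 by (simp add: root_weight_def)
  have s0: "0 \<le> ?s n" using c0 by (simp add: root_weight_def)
  have "(?s (Suc n) - ?s n) * 1 \<le> (?s (Suc n) - ?s n) * (?s (Suc n) + ?s n)"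
    using s1 s0 mono by (intro mult_left_mono) auto
  also have "\<dots> = (?s (Suc n))\<^sup>2 - (?s n)\<^sup>2"
    by (simp add: power2_eq_square algebra_simps)
  also have "\<dots> = \<mu> ^ (2 * n)"
    unfolding root_weight_def using c0[of n] c0[of "Suc n"] by simp
  finally show "?s (Suc n) - ?s n \<le> (\<mu>\<^sup>2) ^ n" by (simp add: power_mult)
qed

lemma summable_diag_sqrt:
  "summable (\<lambda>n. (root_weight \<mu> (Suc n) - root_weight \<mu> n) *\<^sub>R rproj n)"
  unfolding rproj_def
proof (rule summable_weighted_conjugates, rule summable_comparison_test')
  show "summable (\<lambda>n. (\<mu>\<^sup>2) ^ n)" using sq_less_1 by (simp add: summable_geometric)
  show "norm \<bar>root_weight \<mu> (Suc n) - root_weight \<mu> n\<bar> \<le> (\<mu>\<^sup>2) ^ n" if "0 \<le> n" for n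
    using root_weight_diff_bounds[of n] by simp
qed

lemma positive_op_diag_sqrt: "positive_op (diag_sqrt \<mu>)"
  unfolding diag_sqrt_def
  by (intro positive_op_suminf summable_diag_sqrt positive_op_scaleR positive_op_rproj
      root_weight_diff_bounds(1))

text \<open>The identity holds exactly for partial sums: the first \<open>N\<close> terms act on the
  range of \<open>rproj N\<close> as the scalar \<open>root_weight \<mu> N\<close>, so adding a term
  completes the square.\<close>

lemma diag_sqrt_square: "diag_sqrt \<mu> * diag_sqrt \<mu> = diag_square \<mu>"
proof -
  let ?w = "\<lambda>n. root_weight \<mu> (Suc n) - root_weight \<mu> n"
  let ?B = "\<lambda>N. \<Sum>n<N. ?w n *\<^sub>R rproj n" and ?A = "\<lambda>N. \<Sum>n<N. (\<mu>\<^sup>2) ^ n *\<^sub>R rproj n"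
  have w_sum: "(\<Sum>n<N. ?w n) = root_weight \<mu> N" for N
    using sum_lessThan_telescope[of "root_weight \<mu>" N] by (simp add: root_weight_def)
  have BE: "?B N * rproj N = root_weight \<mu> N *\<^sub>R rproj N" "rproj N * ?B N = root_weight \<mu> N *\<^sub>R rproj N" for N
  proof -
    have "?B N * rproj N = (\<Sum>n<N. ?w n *\<^sub>R rproj N)"
      unfolding sum_distrib_right by (intro sum.cong) (simp_all add: rproj_mult_le)
    then show "?B N * rproj N = root_weight \<mu> N *\<^sub>R rproj N"
      by (simp only: scaleR_left.sum[symmetric] w_sum)
    have "rproj N * ?B N = (\<Sum>n<N. ?w n *\<^sub>R rproj N)"
      unfolding sum_distrib_left by (intro sum.cong) (simp_all add: rproj_mult_le)
    then show "rproj N * ?B N = root_weight \<mu> N *\<^sub>R rproj N"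
      by (simp only: scaleR_left.sum[symmetric] w_sum)
  qed
  have "?B N * ?B N = ?A N" for N
  proof (induction N)
    case (Suc N)
    have c0: "(\<Sum>k<n. \<mu> ^ (2 * k)) \<ge> 0" for n by (intro sum_nonneg) simp
    have sq: "(root_weight \<mu> (Suc N))\<^sup>2 = (root_weight \<mu> N)\<^sup>2 + (\<mu>\<^sup>2) ^ N"
      unfolding root_weight_def using c0[of N] c0[of "Suc N"] by (simp add: power_mult)
    have "?B (Suc N) * ?B (Suc N) = ?B N * ?B N + ?w N *\<^sub>R (?B N * rproj N)
        + ?w N *\<^sub>R (rproj N * ?B N) + (?w N * ?w N) *\<^sub>R (rproj N * rproj N)"
      by (simp add: distrib_left distrib_right scaleR_add_right add.assoc)
    also have "\<dots> = ?A N + (2 * ?w N * root_weight \<mu> N + ?w N * ?w N) *\<^sub>R rproj N"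
      unfolding BE Suc.IH by (simp add: rproj_mult_le scaleR_add_left mult.assoc flip: scaleR_2)
    also have "2 * ?w N * root_weight \<mu> N + ?w N * ?w N = (root_weight \<mu> (Suc N))\<^sup>2 - (root_weight \<mu> N)\<^sup>2"
      by (simp add: power2_eq_square algebra_simps)
    finally show ?case using sq by simp
  qed simp
  moreover have "(\<lambda>N. ?B N * ?B N) \<longlonglongrightarrow> diag_sqrt \<mu> * diag_sqrt \<mu>"
    unfolding diag_sqrt_def by (intro tendsto_mult summable_LIMSEQ summable_diag_sqrt)
  moreover have "?A \<longlonglongrightarrow> diag_square \<mu>"
    unfolding amplify_def rproj_def by (intro summable_LIMSEQ summable_amplify sq_less_1)
  ultimately show ?thesis using LIMSEQ_unique by simp
qed

lemma op_sqrt_diag_square: "op_sqrt (diag_square \<mu>) = diag_sqrt \<mu>"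
  by (rule op_sqrt_eqI[OF positive_op_diag_sqrt diag_sqrt_square])

lemma adj_diag_sqrt: "adj (diag_sqrt \<mu>) = diag_sqrt \<mu>"
  by (rule positive_op_selfadjoint[OF positive_op_diag_sqrt])

text \<open>Every term of the series starts with \<open>t\<close>. The cases of use are
  \<open>c = 1\<close> with the range projection and \<open>c = 0\<close> with adjoints of the other
  isometries.\<close>

lemma mult_diag_sqrt:
  assumes "A * t = c *\<^sub>R t"
  shows "A * diag_sqrt \<mu> = c *\<^sub>R diag_sqrt \<mu>"
proof -
  have "A * rproj n = c *\<^sub>R rproj n" for n
    unfolding rproj_def using assms by (cases n) (simp_all add: mult.assoc[symmetric])
  then have "A * (r *\<^sub>R rproj n) = c *\<^sub>R (r *\<^sub>R rproj n)" for n r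
    by simp
  then show ?thesis
    unfolding diag_sqrt_def
    by (simp only: suminf_mult[OF summable_diag_sqrt, symmetric] suminf_scaleR_right[OF summable_diag_sqrt])
qed

lemma diag_sqrt_t_mult_adj: "diag_sqrt \<mu> * t * adj (diag_sqrt \<mu> * t) = diag_square \<mu>"
proof -
  have "t * adj t * diag_sqrt \<mu> = diag_sqrt \<mu>"
    using mult_diag_sqrt[of "t * adj t" 1] partial by simp
  then show ?thesis by (simp add: adj_diag_sqrt mult.assoc diag_sqrt_square)
qed

lemma e_diag_square: "e * diag_square \<mu> = diag_square \<mu>"
  by (rule amplify_left_fixed[OF sq_less_1 range_le]) (simp add: mult.assoc[symmetric] range_le)

lemma diag_square_e: "diag_square \<mu> * e = diag_square \<mu>"
  by (rule amplify_right_fixed[OF sq_less_1 adj_range_le]) (simp add: mult.assoc adj_range_le)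

text \<open>With \<open>diag_sqrt_t_mult_adj\<close> this is the relation for a single generator,
  with \<open>e\<close> as the unit.\<close>

lemma adj_mult_diag_sqrt_t: "adj (diag_sqrt \<mu> * t) * (diag_sqrt \<mu> * t) = e + \<mu>\<^sup>2 *\<^sub>R diag_square \<mu>"
proof -
  have "adj (diag_sqrt \<mu> * t) * (diag_sqrt \<mu> * t) = adj t * diag_square \<mu> * t"
    by (simp add: adj_diag_sqrt mult.assoc diag_sqrt_square[symmetric])
  also have "\<dots> = e * e + \<mu>\<^sup>2 *\<^sub>R (e * diag_square \<mu> * e)"
    by (subst amplify_fixpoint[OF sq_less_1]) (simp add: distrib_left distrib_right mult.assoc)
  finally show ?thesis by (simp only: e_e e_diag_square diag_square_e)
qed

text \<open>The source of the correction sum in the relations: one amplification turns the smaller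
  corner projection into the larger one minus a multiple of
  \<open>diag_square \<mu>\<close>.\<close>

lemma amplify_complement: "amplify (\<mu>\<^sup>2) t (e - t * adj t) = e - (1 - \<mu>\<^sup>2) *\<^sub>R diag_square \<mu>"
proof (rule amplify_unique[OF sq_less_1])
  have fp: "diag_square \<mu> = t * adj t + \<mu>\<^sup>2 *\<^sub>R (t * diag_square \<mu> * adj t)"
    by (rule amplify_fixpoint[OF sq_less_1])
  have "t * e * adj t = t * adj t" by (simp only: t_e)
  then have "e - t * adj t + \<mu>\<^sup>2 *\<^sub>R (t * (e - (1 - \<mu>\<^sup>2) *\<^sub>R diag_square \<mu>) * adj t)
     = e - (1 - \<mu>\<^sup>2) *\<^sub>R (t * adj t + \<mu>\<^sup>2 *\<^sub>R (t * diag_square \<mu> * adj t))"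
    by (simp add: right_diff_distrib left_diff_distrib scaleR_diff_right scaleR_diff_left scaleR_add_right)
  then show "e - (1 - \<mu>\<^sup>2) *\<^sub>R diag_square \<mu>
     = e - t * adj t + \<mu>\<^sup>2 *\<^sub>R (t * (e - (1 - \<mu>\<^sup>2) *\<^sub>R diag_square \<mu>) * adj t)"
    using fp by simp
qed

text \<open>By the fixed-point equation the form of \<open>diag_square \<mu>\<close> dominates the
  squared norm of \<open>adj t x\<close>.\<close>

lemma op_ker_diag_sqrt: "op_ker (diag_sqrt \<mu>) \<subseteq> op_ker (adj t)"
proof
  fix x assume "x \<in> op_ker (diag_sqrt \<mu>)"
  then have "bop_apply (diag_square \<mu>) x = 0"
    by (simp add: op_ker_def diag_sqrt_square[symmetric] bop_apply_simps bop.zero_right)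
  then have "0 = Re (cinner x (bop_apply (diag_square \<mu>) x))" by simp
  also have "\<dots> = (norm (bop_apply (adj t) x))\<^sup>2
      + \<mu>\<^sup>2 * Re (cinner x (bop_apply (t * diag_square \<mu> * adj t) x))"
    by (subst amplify_fixpoint[OF sq_less_1])
      (simp add: norm_bop_apply_squared bop_apply_simps cinner_add_right cinner_scaleR_right)
  finally have eq: "0 = (norm (bop_apply (adj t) x))\<^sup>2
      + \<mu>\<^sup>2 * Re (cinner x (bop_apply (t * diag_square \<mu> * adj t) x))" .
  have "(norm (bop_apply (adj t) x))\<^sup>2 \<le> 0"
  proof -
    have "positive_op (diag_square \<mu>)"
      using sq_less_1 by (intro positive_op_amplify positive_op_self_mult_adj) auto
    then have "0 \<le> Re (cinner x (bop_apply (t * diag_square \<mu> * adj t) x))"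
      by (intro positive_opD positive_op_conjugate)
    then have "0 \<le> \<mu>\<^sup>2 * Re (cinner x (bop_apply (t * diag_square \<mu> * adj t) x))" by simp
    then show ?thesis using eq by linarith
  qed
  then show "x \<in> op_ker (adj t)" by (simp add: op_ker_def)
qed

text \<open>Passing \<open>t\<close> from one side or \<open>adj t\<close> from the other costs the
  same factor \<mu>, so commutation survives conjugation by \<open>t\<close>. Nothing is divided by
  \<mu>, so \<mu> = 0 is included.\<close>

lemma commutes_diag_sqrt:
  assumes c: "adj t * c = \<mu> *\<^sub>R (c * adj t)" "c * t = \<mu> *\<^sub>R (t * c)"
  shows "c * diag_sqrt \<mu> = diag_sqrt \<mu> * c"
proof -
  have "c * rproj n = rproj n * c" for n
  proof (induction n)
    case 0
    have "c * t * adj t = \<mu> *\<^sub>R (t * c * adj t)" using c(2) by simp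
    moreover have "t * (adj t * c) = \<mu> *\<^sub>R (t * c * adj t)" using c(1) by (simp add: mult.assoc)
    ultimately show ?case by (simp add: rproj_def mult.assoc)
  next
    case (Suc n)
    have "c * rproj (Suc n) = (c * t) * rproj n * adj t" by (simp add: rproj_Suc mult.assoc)
    also have "\<dots> = \<mu> *\<^sub>R (t * (c * rproj n) * adj t)" by (simp add: c(2) mult.assoc)
    also have "\<dots> = t * rproj n * (\<mu> *\<^sub>R (c * adj t))" by (simp add: Suc.IH mult.assoc)
    also have "\<dots> = rproj (Suc n) * c" by (simp add: c(1)[symmetric] rproj_Suc mult.assoc)
    finally show ?case .
  qed
  then show ?thesis
    unfolding diag_sqrt_def
    by (simp add: suminf_mult[OF summable_diag_sqrt, symmetric] suminf_mult2[OF summable_diag_sqrt])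
qed

text \<open>Here \<open>b\<close> is the last stage for the smaller of two indices and
  \<open>c\<close> the stage of the other operator at that level. The factor \<mu> comes from moving
  \<open>c\<close> past \<open>t\<close> or \<open>adj t\<close>, since \<open>c\<close> commutes
  with the root.\<close>

lemma corner_relations:
  assumes Y: "adj t * Y = 0" "Y * t = 0" "e * Y = Y" "Y * e = Y"
  defines "b \<equiv> diag_sqrt \<mu> * t" and "c \<equiv> amplify \<mu> t Y"
  shows "c * b = \<mu> *\<^sub>R (b * c)" "adj b * c = \<mu> *\<^sub>R (c * adj b)"
proof -
  have tc: "adj t * c = \<mu> *\<^sub>R (c * adj t)" unfolding c_def by (rule adj_t_amplify[OF \<mu> Y(1,3)])
  have ct: "c * t = \<mu> *\<^sub>R (t * c)" unfolding c_def by (rule amplify_t[OF \<mu> Y(2,4)])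
  have comm: "c * diag_sqrt \<mu> = diag_sqrt \<mu> * c" by (rule commutes_diag_sqrt[OF tc ct])
  have "c * b = diag_sqrt \<mu> * (c * t)" by (simp add: b_def mult.assoc[symmetric] comm)
  then show "c * b = \<mu> *\<^sub>R (b * c)" by (simp add: ct b_def mult.assoc)
  have "adj b * c = adj t * c * diag_sqrt \<mu>"
    by (simp add: b_def adj_diag_sqrt mult.assoc comm)
  then show "adj b * c = \<mu> *\<^sub>R (c * adj b)"
    by (simp add: tc b_def adj_diag_sqrt mult.assoc)
qed

end

end

section \<open>Families of twisted isometries\<close>

locale twisted_isometries =
  fixes d :: nat and t :: "nat \<Rightarrow> 'h::complex_hilbert_space bop"
  assumes adj_mult: "\<And>i j. i \<in> {1..d} \<Longrightarrow> j \<in> {1..d} \<Longrightarrow>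
      adj (t i) * t j = (if i = j then 1 - (\<Sum>k\<in>{1..<i}. t k * adj (t k)) else 0)"
    and mult_zero: "\<And>i j. i \<in> {1..d} \<Longrightarrow> j \<in> {1..d} \<Longrightarrow> i < j \<Longrightarrow> t j * t i = 0"
begin

definition Q :: "nat \<Rightarrow> 'h bop" where
  "Q i = 1 - (\<Sum>k\<in>{1..<i}. t k * adj (t k))"

lemma Q_Suc: "1 \<le> i \<Longrightarrow> Q (Suc i) = Q i - t i * adj (t i)"
  by (simp add: Q_def)

lemma adj_Q: "adj (Q i) = Q i"
  by (simp add: Q_def adj_sum)

lemma Q_mult:
  assumes "\<And>j. j \<in> {1..k} \<Longrightarrow> adj (t j) * X = 0"
  shows "Q (Suc k) * X = X"
proof -
  have "(\<Sum>j\<in>{1..<Suc k}. t j * adj (t j)) * X = 0"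
    unfolding sum_distrib_right using assms by (intro sum.neutral) (auto simp: mult.assoc)
  then show ?thesis by (simp add: Q_def left_diff_distrib)
qed

lemma mult_Q:
  assumes "\<And>j. j \<in> {1..k} \<Longrightarrow> X * t j = 0"
  shows "X * Q (Suc k) = X"
proof -
  have "X * (\<Sum>j\<in>{1..<Suc k}. t j * adj (t j)) = 0"
    unfolding sum_distrib_left using assms by (intro sum.neutral) (auto simp: mult.assoc[symmetric])
  then show ?thesis by (simp add: Q_def right_diff_distrib)
qed

lemma adj_t_t: "Suc k \<le> d \<Longrightarrow> adj (t (Suc k)) * t (Suc k) = Q (Suc k)"
  by (simp add: adj_mult Q_def)

text \<open>The vanishing products on either side of \<open>t (Suc k)\<close> make it fixed by
  \<open>Q (Suc k)\<close> from both sides, and that projection is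
  \<open>adj (t (Suc k)) * t (Suc k)\<close>.\<close>

lemma corner_isometry_t: "Suc k \<le> d \<Longrightarrow> corner_isometry (t (Suc k))"
proof
  assume k: "Suc k \<le> d"
  show "t (Suc k) * adj (t (Suc k)) * t (Suc k) = t (Suc k)"
    unfolding mult.assoc adj_t_t[OF k] using k by (intro mult_Q mult_zero) auto
  show "adj (t (Suc k)) * t (Suc k) * t (Suc k) = t (Suc k)"
    unfolding adj_t_t[OF k] using k by (intro Q_mult) (simp add: adj_mult)
qed

lemma contraction_t:
  assumes "Suc k \<le> d"
  shows "contraction (t (Suc k))"
proof -
  interpret corner_isometry "t (Suc k)" using assms by (rule corner_isometry_t)
  show ?thesis by unfold_locales
qed

section \<open>Corners and iterated amplification\<close>

definition corner :: "nat \<Rightarrow> 'h bop set" where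
  "corner k = {X. \<forall>j\<in>{1..k}. adj (t j) * X = 0 \<and> X * t j = 0}"

text \<open>Corners are encoded by annihilation, the form the \<open>amplify\<close> lemmas consume;
  this recovers the description by compression.\<close>

lemma corner_Q: "X \<in> corner k \<Longrightarrow> Q (Suc k) * X = X" "X \<in> corner k \<Longrightarrow> X * Q (Suc k) = X"
  by (auto simp: corner_def intro!: Q_mult mult_Q)

lemma corner_adj: "X \<in> corner k \<Longrightarrow> adj X \<in> corner k"
proof -
  assume X: "X \<in> corner k"
  have "adj (t j) * adj X = 0 \<and> adj X * t j = 0" if "j \<in> {1..k}" for j
  proof -
    have "X * t j = 0" "adj (t j) * X = 0" using X that by (simp_all add: corner_def)
    from arg_cong[OF this(1), of adj] arg_cong[OF this(2), of adj] show ?thesis by simp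
  qed
  then show ?thesis by (simp add: corner_def)
qed

lemma corner_amplify:
  assumes "Suc k \<le> d" "\<bar>\<nu>\<bar> < 1" "X \<in> corner (Suc k)"
  shows "amplify \<nu> (t (Suc k)) X \<in> corner k"
proof -
  interpret c: contraction "t (Suc k)" using assms(1) by (rule contraction_t)
  have "adj (t j) * amplify \<nu> (t (Suc k)) X = 0 \<and> amplify \<nu> (t (Suc k)) X * t j = 0"
    if j: "j \<in> {1..k}" for j
  proof -
    have "adj (t j) * t (Suc k) = 0" "adj (t (Suc k)) * t j = 0"
      using j assms(1) by (simp_all add: adj_mult)
    moreover have "adj (t j) * X = 0" "X * t j = 0"
      using j assms(3) by (simp_all add: corner_def)
    ultimately show ?thesis
      by (simp add: c.amplify_left_annihilator c.amplify_right_annihilator assms(2))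
  qed
  then show ?thesis by (simp add: corner_def)
qed

text \<open>Amplification runs along \<open>t k\<close> first and \<open>t 1\<close> last, the order
  in which the stages descend.\<close>

primrec iter_amplify :: "real \<Rightarrow> nat \<Rightarrow> 'h bop \<Rightarrow> 'h bop" where
  "iter_amplify \<nu> 0 X = X"
| "iter_amplify \<nu> (Suc k) X = iter_amplify \<nu> k (amplify \<nu> (t (Suc k)) X)"

context
  fixes \<nu> :: real
  assumes \<nu>: "\<bar>\<nu>\<bar> < 1"
begin

lemma iter_amplify_add:
  "k \<le> d \<Longrightarrow> iter_amplify \<nu> k (X + Y) = iter_amplify \<nu> k X + iter_amplify \<nu> k Y"
  by (induction k arbitrary: X Y) (simp_all add: contraction.amplify_add[OF contraction_t \<nu>])

lemma iter_amplify_scaleR: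
  "k \<le> d \<Longrightarrow> iter_amplify \<nu> k (r *\<^sub>R X) = r *\<^sub>R iter_amplify \<nu> k X"
  by (induction k arbitrary: X) (simp_all add: contraction.amplify_scaleR[OF contraction_t \<nu>])

lemma iter_amplify_diff:
  "k \<le> d \<Longrightarrow> iter_amplify \<nu> k (X - Y) = iter_amplify \<nu> k X - iter_amplify \<nu> k Y"
  using iter_amplify_add[of k "X - Y" Y] by simp

lemma adj_iter_amplify:
  "k \<le> d \<Longrightarrow> adj (iter_amplify \<nu> k X) = iter_amplify \<nu> k (adj X)"
  by (induction k arbitrary: X) (simp_all add: contraction.adj_amplify[OF contraction_t \<nu>])

lemma positive_op_iter_amplify:
  "k \<le> d \<Longrightarrow> 0 \<le> \<nu> \<Longrightarrow> positive_op X \<Longrightarrow> positive_op (iter_amplify \<nu> k X)"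
  using \<nu> by (induction k arbitrary: X) (simp_all add: contraction.positive_op_amplify[OF contraction_t])

lemma iter_amplify_mult_annihilator:
  "k \<le> d \<Longrightarrow> (\<And>j. j \<in> {1..k} \<Longrightarrow> adj (t j) * A = 0) \<Longrightarrow> iter_amplify \<nu> k X * A = X * A"
  by (induction k arbitrary: X) (simp_all add: contraction.amplify_right_annihilator[OF contraction_t \<nu>])

text \<open>This transports identities between products from a corner to the whole space; at each
  level \<open>corner_amplify\<close> supplies the annihilation hypotheses for the next.\<close>

lemma iter_amplify_mult:
  assumes \<kappa>: "\<bar>\<kappa>\<bar> < 1"
  shows "k \<le> d \<Longrightarrow> X \<in> corner k \<Longrightarrow> Y \<in> corner k \<Longrightarrow>
    iter_amplify \<nu> k X * iter_amplify \<kappa> k Y = iter_amplify (\<nu> * \<kappa>) k (X * Y)"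
proof (induction k arbitrary: X Y)
  case (Suc k)
  have Y: "adj (t (Suc k)) * Y = 0" "X * t (Suc k) = 0"
    using Suc.prems by (simp_all add: corner_def)
  have "Y \<in> corner k" using Suc.prems by (simp add: corner_def)
  then have "adj (t (Suc k)) * t (Suc k) * Y = Y"
    using Suc.prems(1) by (simp only: adj_t_t corner_Q)
  then have "amplify \<nu> (t (Suc k)) X * amplify \<kappa> (t (Suc k)) Y = amplify (\<nu> * \<kappa>) (t (Suc k)) (X * Y)"
    using corner_isometry.amplify_mult[OF corner_isometry_t \<nu> \<kappa> Y(2,1)] Suc.prems(1) by simp
  then show ?case
    using Suc.IH[OF _ corner_amplify[OF Suc.prems(1) \<nu> Suc.prems(2)]
        corner_amplify[OF Suc.prems(1) \<kappa> Suc.prems(3)]] Suc.prems(1) by simp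
qed simp

end

section \<open>The operators \<open>a_tilde\<close>, their relations and polar parts\<close>

abbreviation "B \<mu> i \<equiv> corner_isometry.diag_sqrt (t i) \<mu>"

text \<open>For \<bar>\<mu>\<bar> < 1 and \<open>i\<close> in \<open>{1..d}\<close> this is the
  square of \<open>B \<mu> i\<close>.\<close>

abbreviation "A \<mu> i \<equiv> amplify (\<mu>\<^sup>2) (t i) (t i * adj (t i))"

context
  fixes \<mu> :: real
  assumes \<mu>: "\<bar>\<mu>\<bar> < 1"
begin

lemma weight_bounds: "\<bar>\<mu>\<^sup>2\<bar> < 1" "\<bar>\<bar>\<mu>\<bar>\<bar> < 1"
  using \<mu> by (simp_all add: abs_square_less_1)

lemma B_corner:
  assumes "Suc k \<le> d"
  shows "B \<mu> (Suc k) \<in> corner k"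
proof -
  interpret c: corner_isometry "t (Suc k)" using assms by (rule corner_isometry_t)
  have 1: "adj (t j) * B \<mu> (Suc k) = 0" if "j \<in> {1..k}" for j
    using c.mult_diag_sqrt[OF \<mu>, of "adj (t j)" 0] that assms by (simp add: adj_mult)
  moreover have "B \<mu> (Suc k) * t j = 0" if "j \<in> {1..k}" for j
    using arg_cong[OF 1[OF that], of adj] by (simp add: c.adj_diag_sqrt[OF \<mu>])
  ultimately show ?thesis by (simp add: corner_def)
qed

lemma b_corner:
  assumes "Suc k \<le> d"
  shows "B \<mu> (Suc k) * t (Suc k) \<in> corner k"
proof -
  have "t (Suc k) * t j = 0" if "j \<in> {1..k}" for j
    using that assms by (intro mult_zero) auto
  then show ?thesis
    using B_corner[OF assms] by (simp add: corner_def mult.assoc) (simp add: mult.assoc[symmetric])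
qed

lemma diag_term_eq:
  "diag_term \<mu> t i = (\<lambda>n. (\<mu>\<^sup>2) ^ n *\<^sub>R (t i ^ n * (t i * adj (t i)) * adj (t i) ^ n))"
  by (rule ext) (simp only: diag_term_def power_mult power_Suc2[of "t i"]
      power_Suc[of "adj (t i)"] mult.assoc)

lemma a_stage_diag:
  assumes "Suc k \<le> d"
  shows "a_stage \<mu> t (Suc k) (Suc k) = B \<mu> (Suc k) * t (Suc k)"
  using corner_isometry.op_sqrt_diag_square[OF corner_isometry_t \<mu>, of k] assms
  by (simp add: a_stage.simps[of \<mu> t "Suc k" "Suc k"] diag_term_eq amplify_def)

lemma a_stage_step:
  "Suc k < i \<Longrightarrow> a_stage \<mu> t i (Suc k) = amplify \<mu> (t (Suc k)) (a_stage \<mu> t i (Suc (Suc k)))"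
  by (simp add: a_stage.simps[of \<mu> t i "Suc k"] amplify_def)

lemma a_stage_corner:
  assumes "k \<le> m" "Suc m \<le> d"
  shows "a_stage \<mu> t (Suc m) (Suc k) \<in> corner k"
  using assms(1)
proof (induction k rule: inc_induct)
  case base
  show ?case unfolding a_stage_diag[OF assms(2)] by (rule b_corner[OF assms(2)])
next
  case (step n)
  then show ?case
    using assms(2) by (simp only: a_stage_step Suc_less_eq) (intro corner_amplify \<mu>, auto)
qed

lemma a_tilde_eq: "k < i \<Longrightarrow> a_tilde \<mu> t i = iter_amplify \<mu> k (a_stage \<mu> t i (Suc k))"
  by (induction k) (simp_all add: a_tilde_def a_stage_step)

lemma a_tilde_diag:
  "Suc k \<le> d \<Longrightarrow> a_tilde \<mu> t (Suc k) = iter_amplify \<mu> k (B \<mu> (Suc k) * t (Suc k))"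
  by (simp add: a_tilde_eq[of k] a_stage_diag)

lemma a_tilde_mult_adj:
  assumes "Suc k \<le> d"
  shows "a_tilde \<mu> t (Suc k) * adj (a_tilde \<mu> t (Suc k)) = iter_amplify (\<mu>\<^sup>2) k (A \<mu> (Suc k))"
  using assms corner_isometry.diag_sqrt_t_mult_adj[OF corner_isometry_t[OF assms] \<mu>]
  \<comment> \<open>The rule \<open>adj_simps(7)\<close> is removed so that the adjoint of
    \<open>B * t\<close> stays folded and matches the corner identity.\<close>
  by (simp add: a_tilde_diag adj_iter_amplify[OF \<mu>] iter_amplify_mult[OF \<mu> \<mu>] b_corner corner_adj
      power2_eq_square del: adj_simps(7))

text \<open>By \<open>amplify_complement\<close> each level replaces \<open>Q (Suc (Suc k))\<close>
  by \<open>Q (Suc k)\<close> and leaves behind one summand; the descent ends at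
  \<open>Q 1 = 1\<close>.\<close>

lemma iter_amplify_Q:
  "k \<le> d \<Longrightarrow> iter_amplify (\<mu>\<^sup>2) k (Q (Suc k)) =
    1 - (1 - \<mu>\<^sup>2) *\<^sub>R (\<Sum>j\<in>{1..<Suc k}. a_tilde \<mu> t j * adj (a_tilde \<mu> t j))"
proof (induction k)
  case (Suc k)
  have "amplify (\<mu>\<^sup>2) (t (Suc k)) (Q (Suc (Suc k))) = Q (Suc k) - (1 - \<mu>\<^sup>2) *\<^sub>R A \<mu> (Suc k)"
    using corner_isometry.amplify_complement[OF corner_isometry_t[OF Suc.prems] \<mu>]
    by (simp add: Q_Suc adj_t_t[OF Suc.prems])
  then show ?case
    using Suc by (simp add: iter_amplify_diff[OF weight_bounds(1)] iter_amplify_scaleR[OF weight_bounds(1)]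
        a_tilde_mult_adj scaleR_add_right)
qed (simp add: Q_def)

text \<open>The single-generator relation in the corner is amplified with weight
  \<open>\<mu>\<^sup>2\<close>; its unit \<open>Q (Suc k)\<close> then becomes 1 minus the
  sum.\<close>

lemma adj_mult_a_tilde:
  assumes "Suc k \<le> d"
  shows "adj (a_tilde \<mu> t (Suc k)) * a_tilde \<mu> t (Suc k) =
    1 + \<mu>\<^sup>2 *\<^sub>R (a_tilde \<mu> t (Suc k) * adj (a_tilde \<mu> t (Suc k)))
      - (1 - \<mu>\<^sup>2) *\<^sub>R (\<Sum>j\<in>{1..<Suc k}. a_tilde \<mu> t j * adj (a_tilde \<mu> t j))"
proof -
  have "adj (a_tilde \<mu> t (Suc k)) * a_tilde \<mu> t (Suc k) =
      iter_amplify (\<mu>\<^sup>2) k (Q (Suc k) + \<mu>\<^sup>2 *\<^sub>R A \<mu> (Suc k))"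
    using assms corner_isometry.adj_mult_diag_sqrt_t[OF corner_isometry_t[OF assms] \<mu>]
    by (simp add: a_tilde_diag adj_iter_amplify[OF \<mu>] iter_amplify_mult[OF \<mu> \<mu>] b_corner corner_adj
        power2_eq_square adj_t_t del: adj_simps(7))
  then show ?thesis
    using assms by (simp add: iter_amplify_add[OF weight_bounds(1)] iter_amplify_scaleR[OF weight_bounds(1)]
        iter_amplify_Q a_tilde_mult_adj)
qed

text \<open>Both operators are amplified along the first \<open>k\<close> isometries from the same
  corner, so it suffices to compare them there by \<open>corner_relations\<close>.\<close>

lemma a_tilde_commutation:
  assumes "Suc k < j" "j \<le> d"
  shows "a_tilde \<mu> t j * a_tilde \<mu> t (Suc k) = \<mu> *\<^sub>R (a_tilde \<mu> t (Suc k) * a_tilde \<mu> t j)"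
    and "adj (a_tilde \<mu> t (Suc k)) * a_tilde \<mu> t j = \<mu> *\<^sub>R (a_tilde \<mu> t j * adj (a_tilde \<mu> t (Suc k)))"
proof -
  have k: "Suc k \<le> d" using assms by simp
  obtain m where j: "j = Suc m" using assms(1) by (cases j) auto
  define Y where "Y = a_stage \<mu> t j (Suc (Suc k))"
  define b where "b = B \<mu> (Suc k) * t (Suc k)"
  define c where "c = amplify \<mu> (t (Suc k)) Y"
  have Y: "Y \<in> corner (Suc k)"
    unfolding Y_def j using assms j by (intro a_stage_corner) auto
  then have Yk: "Y \<in> corner k" by (simp add: corner_def)
  have "adj (t (Suc k)) * Y = 0" "Y * t (Suc k) = 0" using Y by (simp_all add: corner_def)
  moreover have "adj (t (Suc k)) * t (Suc k) * Y = Y" "Y * (adj (t (Suc k)) * t (Suc k)) = Y"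
    using corner_Q[OF Yk] by (simp_all only: adj_t_t[OF k])
  ultimately have rel: "c * b = \<mu> *\<^sub>R (b * c)" "adj b * c = \<mu> *\<^sub>R (c * adj b)"
    unfolding b_def c_def by (rule corner_isometry.corner_relations[OF corner_isometry_t[OF k] \<mu>])+
  have cor: "b \<in> corner k" "c \<in> corner k"
    unfolding b_def c_def by (rule b_corner[OF k]) (rule corner_amplify[OF k \<mu> Y])
  have a: "a_tilde \<mu> t (Suc k) = iter_amplify \<mu> k b" "a_tilde \<mu> t j = iter_amplify \<mu> k c"
    using assms k by (simp_all add: a_tilde_diag b_def c_def Y_def a_tilde_eq[of k j] a_stage_step)
  have sq: "\<bar>\<mu> * \<mu>\<bar> < 1" using weight_bounds(1) by (simp add: power2_eq_square)
  show "a_tilde \<mu> t j * a_tilde \<mu> t (Suc k) = \<mu> *\<^sub>R (a_tilde \<mu> t (Suc k) * a_tilde \<mu> t j)"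
    using k by (simp add: a iter_amplify_mult[OF \<mu> \<mu>] cor rel iter_amplify_scaleR[OF sq])
  show "adj (a_tilde \<mu> t (Suc k)) * a_tilde \<mu> t j = \<mu> *\<^sub>R (a_tilde \<mu> t j * adj (a_tilde \<mu> t (Suc k)))"
    using k by (simp add: a adj_iter_amplify[OF \<mu>] iter_amplify_mult[OF \<mu> \<mu>] cor corner_adj rel
        iter_amplify_scaleR[OF sq])
qed

text \<open>The weights of the absolute value \<open>C\<close> are \<open>\<bar>\<mu>\<bar>\<^sup>n\<close> rather than \<open>\<mu>\<^sup>n\<close>, so for \<open>\<mu> < 0\<close> the isometry
  \<open>polar_S\<close> carries signs; compressing by \<open>Q\<close> keeps only the term \<open>n = 0\<close>.\<close>

lemma Q_polar_S:
  assumes k: "Suc k \<le> d"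
  shows "Q (Suc k) * polar_S (a_tilde \<mu> t (Suc k)) = t (Suc k)"
proof -
  interpret c: corner_isometry "t (Suc k)" using k by (rule corner_isometry_t)
  let ?a = "a_tilde \<mu> t (Suc k)" and ?B = "B \<mu> (Suc k)" and ?Q = "Q (Suc k)" and ?t = "t (Suc k)"
  \<comment> \<open>\<bar>\<mu>\<bar> has the same square as \<mu>, so \<open>C * C\<close> is
    right, and being nonnegative it keeps \<open>C\<close> positive.\<close>
  define C where "C = iter_amplify \<bar>\<mu>\<bar> k ?B"
  define V where "V = adj (polar_S ?a)"
  note BB = B_corner[OF k]
  have C: "positive_op C"
    unfolding C_def using k by (intro positive_op_iter_amplify weight_bounds c.positive_op_diag_sqrt[OF \<mu>]) auto
  have CC: "C * C = ?a * adj ?a"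
    using k by (simp add: C_def a_tilde_mult_adj iter_amplify_mult[OF weight_bounds(2) weight_bounds(2)] BB
        c.diag_sqrt_square[OF \<mu>] power2_eq_square)
  have V: "adj ?a = V * C" "op_ker V = op_ker C"
    unfolding V_def by (rule polar_S_properties[OF C CC])+
  have tQ: "adj (t j) * ?Q = 0" if "j \<in> {1..k}" for j
  proof -
    have "t j * adj (t j) * t j = t j"
      using corner_isometry.partial[OF corner_isometry_t, of "j - 1"] that k by simp
    then have "t l * adj (t l) * t j = (if l = j then t j else 0)" if "l \<in> {1..<Suc k}" for l
      using that \<open>j \<in> {1..k}\<close> k adj_mult[of l j] by (cases "l = j") (simp_all add: mult.assoc)
    then have "(\<Sum>l\<in>{1..<Suc k}. t l * adj (t l) * t j) = (\<Sum>l\<in>{1..<Suc k}. if l = j then t j else 0)"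
      by (rule sum.cong[OF refl])
    also have "\<dots> = t j" using that by (subst sum.delta) auto
    finally have "?Q * t j = 0"
      unfolding Q_def left_diff_distrib sum_distrib_right by simp
    from arg_cong[OF this, of adj] show ?thesis by (simp add: adj_Q)
  qed
  have CQ: "C * ?Q = ?B"
    unfolding C_def using iter_amplify_mult_annihilator[OF weight_bounds(2) _ tQ] k corner_Q(2)[OF BB] by simp
  have "adj ?a * ?Q = adj (?B * ?t) * ?Q"
    using iter_amplify_mult_annihilator[OF \<mu> _ tQ] k by (simp add: a_tilde_diag adj_iter_amplify[OF \<mu>])
  also have "\<dots> = adj ?t * ?B"
    using corner_Q(2)[OF BB] by (simp add: c.adj_diag_sqrt[OF \<mu>] mult.assoc)
  finally have VB: "V * ?B = adj ?t * ?B" by (simp add: V(1) mult.assoc CQ)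
  \<comment> \<open>\<open>V * ?Q\<close> and \<open>adj ?t\<close> agree on the range of
    \<open>?B\<close> and both vanish on its kernel.\<close>
  have "V * ?Q - adj ?t = 0"
  proof (rule zero_on_range_and_kernel[OF c.adj_diag_sqrt[OF \<mu>]])
    show "(V * ?Q - adj ?t) * ?B = 0"
      by (simp add: left_diff_distrib mult.assoc corner_Q(1)[OF BB] VB)
    show "op_ker ?B \<subseteq> op_ker (V * ?Q - adj ?t)"
    proof
      fix x assume x: "x \<in> op_ker ?B"
      then have "bop_apply ?Q x \<in> op_ker C"
        by (simp add: op_ker_def bop_apply_simps(6)[symmetric] CQ)
      then have "bop_apply ?Q x \<in> op_ker V" unfolding V(2) .
      moreover have "x \<in> op_ker (adj ?t)" using c.op_ker_diag_sqrt[OF \<mu>] x by blast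
      ultimately show "x \<in> op_ker (V * ?Q - adj ?t)" by (simp add: op_ker_def bop_apply_simps)
    qed
  qed
  then have "adj (V * ?Q) = ?t" by simp
  then show ?thesis by (simp add: V_def adj_Q)
qed

text \<open>By strong induction the compression in \<open>hat_S\<close> is \<open>Q i\<close>, so
  \<open>Q_polar_S\<close> applies.\<close>

lemma hat_S_a_tilde: "1 \<le> i \<Longrightarrow> i \<le> d \<Longrightarrow> hat_S (a_tilde \<mu> t) i = t i"
proof (induction i rule: less_induct)
  case (less i)
  then obtain k where i: "i = Suc k" by (cases i) auto
  have eq: "(\<Sum>j\<in>{1..<i}. hat_S (a_tilde \<mu> t) j * adj (hat_S (a_tilde \<mu> t) j)) = (\<Sum>j\<in>{1..<i}. t j * adj (t j))"
    using less by (intro sum.cong) auto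
  show ?case
    unfolding hat_S.simps[of _ i] eq using Q_polar_S[of k] less.prems unfolding i Q_def by blast
qed

end

end

text \<open>As \<open>suminf\<close> is total, the summability conjuncts are what make the infinite
  sums in \<open>a_stage\<close> genuine norm limits.\<close>

theorem theorem1:
  fixes d :: nat and \<mu> :: real
    and t :: "nat \<Rightarrow> 'h::complex_hilbert_space bop" and A0 :: "'h bop set"
  assumes "d \<ge> 1" and "-1 < \<mu>" and "\<mu> < 1"
    and "A0 = unital_cstar_subalgebra hull (t ` {1..d})"
    and "\<And>i j. i \<in> {1..d} \<Longrightarrow> j \<in> {1..d} \<Longrightarrow>
           adj (t i) * t j = (if i = j then 1 - (\<Sum>k\<in>{1..<i}. t k * adj (t k)) else 0)"
    and "\<And>i j. i \<in> {1..d} \<Longrightarrow> j \<in> {1..d} \<Longrightarrow> i < j \<Longrightarrow> t j * t i = 0"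
  defines "a \<equiv> a_tilde \<mu> t"
  shows "(\<forall>i\<in>{1..d}. summable (diag_term \<mu> t i)) \<and>
    (\<forall>i\<in>{1..d}. \<forall>j\<in>{1..<i}.
       summable (\<lambda>n. \<mu> ^ n *\<^sub>R (t j ^ n * a_stage \<mu> t i (Suc j) * adj (t j) ^ n))) \<and>
    (\<forall>i\<in>{1..d}. adj (a i) * a i =
       1 + \<mu>\<^sup>2 *\<^sub>R (a i * adj (a i)) - (1 - \<mu>\<^sup>2) *\<^sub>R (\<Sum>k\<in>{1..<i}. a k * adj (a k))) \<and>
    (\<forall>i\<in>{1..d}. \<forall>j\<in>{1..d}. i \<noteq> j \<longrightarrow> adj (a i) * a j = \<mu> *\<^sub>R (a j * adj (a i))) \<and>
    (\<forall>i\<in>{1..d}. \<forall>j\<in>{1..d}. i < j \<longrightarrow> a j * a i = \<mu> *\<^sub>R (a i * a j)) \<and>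
    (\<forall>i\<in>{1..d}. hat_S a i = t i)"
proof -
  interpret twisted_isometries d t
    using assms(5,6) by unfold_locales
  have \<mu>: "\<bar>\<mu>\<bar> < 1" using assms(2,3) by linarith
  have contr: "contraction (t i)" if "i \<in> {1..d}" for i
    using contraction_t[of "i - 1"] that by simp
  have less: "adj (a i) * a j = \<mu> *\<^sub>R (a j * adj (a i)) \<and> a j * a i = \<mu> *\<^sub>R (a i * a j)"
    if "i \<in> {1..d}" "j \<in> {1..d}" "i < j" for i j
    using a_tilde_commutation[OF \<mu>, of "i - 1" j] that by (simp add: a_def)
  have neq: "adj (a i) * a j = \<mu> *\<^sub>R (a j * adj (a i))"
    if "i \<in> {1..d}" "j \<in> {1..d}" "i \<noteq> j" for i j
  proof (cases "i < j")
    \<comment> \<open>For \<open>j < i\<close> the relation is the adjoint of the one with the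
      indices exchanged, as \<mu> is real.\<close>
    case False
    then have "adj (a j) * a i = \<mu> *\<^sub>R (a i * adj (a j))" using less that by simp
    from arg_cong[OF this, of adj] show ?thesis by simp
  qed (use less that in simp)
  show ?thesis
  proof (intro conjI ballI impI)
    fix i assume i: "i \<in> {1..d}"
    show "summable (diag_term \<mu> t i)"
      unfolding diag_term_eq[OF \<mu>] by (rule contraction.summable_amplify[OF contr[OF i] weight_bounds(1)[OF \<mu>]])
    show "summable (\<lambda>n. \<mu> ^ n *\<^sub>R (t j ^ n * a_stage \<mu> t i (Suc j) * adj (t j) ^ n))"
      if "j \<in> {1..<i}" for j
      using that i by (intro contraction.summable_amplify contr \<mu>) auto
    obtain k where k: "i = Suc k" using i by (cases i) auto
    show "adj (a i) * a i = 1 + \<mu>\<^sup>2 *\<^sub>R (a i * adj (a i)) - (1 - \<mu>\<^sup>2) *\<^sub>R (\<Sum>k\<in>{1..<i}. a k * adj (a k))"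
      using i unfolding a_def k by (intro adj_mult_a_tilde \<mu>) simp
    show "hat_S a i = t i"
      unfolding a_def using i by (intro hat_S_a_tilde \<mu>) auto
  qed (use less neq in auto)
qed

end
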